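(* Let $p \in (0,1/2)$, and let $c$ be the competitive ratio achieved, for probabilistically disoriented linear search with parameter $p$ and one agent, by a randomized $p$-faulty agent that queries an oracle sampling from the uniform distribution finitely many times. Then for every $\epsilon>0$ there is a deterministic $p$-faulty agent (an agent with no access to any random oracle, whose only randomness is its faulty turns) for the same problem with competitive ratio at most $c+\epsilon$.
   Context: Probabilistically disoriented linear search with parameter $p$: a single agent starts at the origin of the real line and moves at speed at most $1$; changing direction costs no extra time. A hidden target is placed at an unknown point $x\in\mathbb{R}$; the agent detects the origin and the target when it walks over them. The agent is $p$-faulty: every attempt to change direction (including after stopping) fails independently with probability $p$ (the agent then keeps moving in the same direction), and the agent is not informed whether an attempt succeeded; it can only infer it from later observations such as visits to the origin. Initially the agent starts moving in a chosen direction without fault. A randomized agent additionally has access to a random oracle independent of the faults; a deterministic agent does not. If $E(x)$ is the expected time at which target $x$ is reached (expectation over faults and any algorithmic randomness), the competitive ratio is $\limsup_{|x|\to\infty} E(x)/|x|$. *)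

theory Defs
  imports "HOL-Probability.Probability"
begin

text \<open>
  An agent acts in discrete steps; the clock advances only during \<open>Walk\<close> steps.
  \<^item> \<open>Turn\<close> is an instantaneous attempt to change direction.
  \<^item> \<open>Walk g d\<close> plans to move in the current direction for \<open>d\<close> time units, having covered
    distance \<open>g r\<close> after \<open>r\<close> of them. Standing still is \<open>g = (\<lambda>_. 0)\<close>.
  \<^item> \<open>Query\<close> asks the random oracle for one sample.
\<close>

datatype action = Turn | Walk "real \<Rightarrow> real" real | Query

text \<open>
  What the agent learns in a step: nothing from a turn attempt (in particular not whether it
  succeeded), the elapsed time and whether it is now at the origin from a walk, and the sample
  from a query. The agent never observes its position or its direction.
\<close>

datatype observation = Silent | Walked real bool | Answer real

text \<open>
  The agent's own past actions are determined by its past observations, so an agent is a map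
  from the observations made so far to the next action.
\<close>

type_synonym agent = "observation list \<Rightarrow> action"

text \<open>A walk never goes backwards and has speed at most 1.\<close>

definition admissible :: "action \<Rightarrow> bool" where
  "admissible a \<longleftrightarrow>
    (\<forall>g d. a = Walk g d \<longrightarrow>
      0 \<le> d \<and> g 0 = 0 \<and>
      (\<forall>s t. 0 \<le> s \<and> s \<le> t \<and> t \<le> d \<longrightarrow> 0 \<le> g t - g s \<and> g t - g s \<le> t - s))"

text \<open>
  The actual duration of a walk from position \<open>y\<close> in direction \<open>\<sigma>\<close> (which is 1 or -1): arriving
  at the origin from elsewhere is noticed at once, so it ends the step and the agent may react.
\<close>

definition walk_duration :: "real \<Rightarrow> real \<Rightarrow> (real \<Rightarrow> real) \<Rightarrow> real \<Rightarrow> real" where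
  "walk_duration y \<sigma> g d =
    (if y \<noteq> 0 \<and> (\<exists>r\<in>{0..d}. y + \<sigma> * g r = 0)
     then Inf {r \<in> {0..d}. y + \<sigma> * g r = 0} else d)"

record state =
  pos :: real
  dir :: real
  moved :: bool
  clock :: real
  hist :: "observation list"

definition init :: state where
  "init = \<lparr>pos = 0, dir = 1, moved = False, clock = 0, hist = []\<rparr>"

text \<open>
  \<open>b\<close> says whether a turn attempt made in this step fails, \<open>v\<close> is the oracle's answer to a query
  made in this step. As long as the agent has not moved, it chooses its initial direction, and
  turns do not fail.
\<close>

definition step :: "agent \<Rightarrow> bool \<Rightarrow> real \<Rightarrow> state \<Rightarrow> state" where
  "step A b v s =
    (case A (hist s) of
       Turn \<Rightarrow>
         s\<lparr>dir := (if moved s \<and> b then dir s else - dir s), hist := hist s @ [Silent]\<rparr>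
     | Walk g d \<Rightarrow>
         (let r = walk_duration (pos s) (dir s) g d;
              y = pos s + dir s * g r
          in s\<lparr>pos := y, moved := (moved s \<or> g r > 0), clock := clock s + r,
               hist := hist s @ [Walked r (y = 0)]\<rparr>)
     | Query \<Rightarrow> s\<lparr>hist := hist s @ [Answer v]\<rparr>)"

primrec run :: "agent \<Rightarrow> bool stream \<times> real stream \<Rightarrow> nat \<Rightarrow> state" where
  "run A \<omega> 0 = init"
| "run A \<omega> (Suc n) = step A (fst \<omega> !! n) (snd \<omega> !! n) (run A \<omega> n)"

definition visits :: "agent \<Rightarrow> bool stream \<times> real stream \<Rightarrow> real \<Rightarrow> real \<Rightarrow> bool" where
  "visits A \<omega> x t \<longleftrightarrow>
    (\<exists>n g d r. A (hist (run A \<omega> n)) = Walk g d \<and>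
       0 \<le> r \<and> r \<le> walk_duration (pos (run A \<omega> n)) (dir (run A \<omega> n)) g d \<and>
       t = clock (run A \<omega> n) + r \<and>
       x = pos (run A \<omega> n) + dir (run A \<omega> n) * g r)"

text \<open>The infimum is infinite if \<open>x\<close> is never visited.\<close>

definition reach_time :: "agent \<Rightarrow> real \<Rightarrow> bool stream \<times> real stream \<Rightarrow> ennreal" where
  "reach_time A x \<omega> = (INF t\<in>{t. visits A \<omega> x t}. ennreal t)"

text \<open>
  Independent faults of probability \<open>p\<close> and, independent of them, independent samples from the
  uniform distribution on the unit interval. Each step has its own fault and its own sample;
  those not consumed by the action of the step are never looked at.
\<close>

definition chance :: "real \<Rightarrow> (bool stream \<times> real stream) measure" where
  "chance p = stream_space (measure_pmf (bernoulli_pmf p))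
     \<Otimes>\<^sub>M stream_space (uniform_measure lborel {0..1})"

text \<open>
  Measurability makes the expected reaching times well defined; it restricts only how the agent
  depends on the real-valued oracle answers.
\<close>

definition faulty_agent :: "real \<Rightarrow> agent \<Rightarrow> bool" where
  "faulty_agent p A \<longleftrightarrow>
    (\<forall>h. admissible (A h)) \<and> (\<forall>x. reach_time A x \<in> borel_measurable (chance p))"

definition deterministic :: "agent \<Rightarrow> bool" where
  "deterministic A \<longleftrightarrow> (\<forall>h. A h \<noteq> Query)"

definition finitely_many_queries :: "real \<Rightarrow> agent \<Rightarrow> bool" where
  "finitely_many_queries p A \<longleftrightarrow>
    (AE \<omega> in chance p. finite {n. A (hist (run A \<omega> n)) = Query})"

definition expected_time :: "real \<Rightarrow> agent \<Rightarrow> real \<Rightarrow> ennreal" where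
  "expected_time p A x = (\<integral>\<^sup>+ \<omega>. reach_time A x \<omega> \<partial>chance p)"

definition competitive_ratio :: "real \<Rightarrow> agent \<Rightarrow> ennreal" where
  "competitive_ratio p A = Limsup at_infinity (\<lambda>x::real. expected_time p A x / ennreal \<bar>x\<bar>)"

end

theory Submission
  imports Defs
begin

text \<open>
  The faults themselves are a source of randomness: an excursion from the origin that attempts one
  turn reveals by the time of the return whether the attempt failed. As \<open>p < 1/2\<close>, walking on
  and doubling the distance after every failure takes an expected time proportional to the size of
  the excursion, so any number of bits is available at the origin in an expected time of at most 1.

  Finitely many bits cannot replace the oracle for all targets at once, but they can for all targets
  up to a given distance. The deterministic agent therefore works in phases. In each of them it draws
  new bits, runs a copy of the given agent with oracle answers computed from these bits until a
  deadline \<open>R k\<close>, and returns to the origin. The \<open>R k\<close> grow so fast that a target much closer than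
  \<open>R k\<close> is missed in that phase with small probability, and that phases whose deadline is much
  smaller than the distance of the target cost little. Only the one phase in between may be
  expensive. Using only every \<open>L\<close>-th deadline, with a random offset drawn at the very beginning,
  makes it occur with probability at most \<open>2 / L\<close>.

  Expected times are truncated at a constant \<open>M\<close>, which makes remainder terms such as \<open>p ^ n * M\<close>
  vanish; in the end \<open>M\<close> tends to infinity.
\<close>

section \<open>Runs from an arbitrary physical state\<close>

text \<open>The obstacle that shapes the proof is that the agent never knows its absolute direction,
  not even at the origin. Every bound at the origin is therefore proved for both directions at once,
  and a phase may run the mirror image of the given agent, so that the targets \<open>x\<close> and
  \<open>- x\<close> are treated together. What the agent does control is the relative direction: an
  excursion returns in the direction opposite to its departure, whether or not its turn failed.

  A missed deadline \<open>S\<close> costs a return of order \<open>S\<close>. Hence it is not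
  enough that a miss is unlikely; \<open>S\<close> times its probability must be small, which holds
  for large \<open>S\<close> because the expected reaching time is finite.

  Deadlines and bits are tuned only to targets at integer distances, of which there are finitely
  many below each deadline.\<close>

type_synonym phys = "real \<times> real \<times> bool"

definition after :: "agent \<Rightarrow> observation \<Rightarrow> agent" where
  "after A z = (\<lambda>h. A (z # h))"

fun dur :: "action \<Rightarrow> phys \<Rightarrow> real" where
  "dur (Walk g d) (y, \<sigma>, m) = walk_duration y \<sigma> g d"
| "dur _ _ = 0"

fun hit :: "real \<Rightarrow> action \<Rightarrow> phys \<Rightarrow> ennreal" where
  "hit x (Walk g d) (y, \<sigma>, m) =
    (INF r\<in>{r. 0 \<le> r \<and> r \<le> walk_duration y \<sigma> g d \<and> x = y + \<sigma> * g r}. ennreal r)"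
| "hit _ _ _ = \<infinity>"

fun move :: "action \<Rightarrow> bool \<Rightarrow> phys \<Rightarrow> phys" where
  "move Turn b (y, \<sigma>, m) = (y, if m \<and> b then \<sigma> else - \<sigma>, m)"
| "move (Walk g d) b (y, \<sigma>, m) =
    (y + \<sigma> * g (walk_duration y \<sigma> g d), \<sigma>, m \<or> g (walk_duration y \<sigma> g d) > 0)"
| "move Query b s = s"

fun observe :: "action \<Rightarrow> real \<Rightarrow> phys \<Rightarrow> observation" where
  "observe Turn u s = Silent"
| "observe (Walk g d) u (y, \<sigma>, m) =
    Walked (walk_duration y \<sigma> g d) (y + \<sigma> * g (walk_duration y \<sigma> g d) = 0)"
| "observe Query u s = Answer u"

text \<open>\<open>run\<close> appends to the history and is built from the last step. This
  recursion peels off the first step instead, from an arbitrary physical state and with the residual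
  agent \<open>after\<close>; in this form an expectation can be conditioned on the first fault. The
  value is infinite if the target is not reached within \<open>n\<close> steps.\<close>

primrec rt :: "real \<Rightarrow> nat \<Rightarrow> agent \<Rightarrow> real stream \<Rightarrow> phys \<Rightarrow> bool stream \<Rightarrow> ennreal" where
  "rt x 0 A v s b = \<infinity>"
| "rt x (Suc n) A v s b = min (hit x (A []) s) (ennreal (dur (A []) s) +
     rt x n (after A (observe (A []) (shd v) s)) (stl v) (move (A []) (shd b) s) (stl b))"

definition reach :: "real \<Rightarrow> agent \<Rightarrow> real stream \<Rightarrow> phys \<Rightarrow> bool stream \<Rightarrow> ennreal" where
  "reach x A v s b = (INF n. rt x n A v s b)"

definition phys_of :: "state \<Rightarrow> phys" where
  "phys_of s = (pos s, dir s, moved s)"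

lemma step_simps:
  "phys_of (step A b u s) = move (A (hist s)) b (phys_of s)"
  "clock (step A b u s) = clock s + dur (A (hist s)) (phys_of s)"
  "hist (step A b u s) = hist s @ [observe (A (hist s)) u (phys_of s)]"
  by (auto simp: step_def phys_of_def Let_def split: action.splits)

lemma admissible_WalkD:
  assumes "admissible (Walk g d)"
  shows "0 \<le> d" "g 0 = 0"
    "\<And>s t. 0 \<le> s \<Longrightarrow> s \<le> t \<Longrightarrow> t \<le> d \<Longrightarrow> g s \<le> g t"
    "\<And>s t. 0 \<le> s \<Longrightarrow> s \<le> t \<Longrightarrow> t \<le> d \<Longrightarrow> g t - g s \<le> t - s"
  using assms unfolding admissible_def by auto

lemma admissible_continuous:
  assumes "admissible (Walk g d)"
  shows "continuous_on {0..d} g"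
proof (rule continuous_on_iff[THEN iffD2], intro ballI allI impI)
  fix t e :: real assume t: "t \<in> {0..d}" "0 < e"
  have "dist (g s) (g t) < e" if "s \<in> {0..d}" "dist s t < e" for s
  proof (cases "s \<le> t")
    case True
    then show ?thesis using admissible_WalkD(3,4)[OF assms, of s t] that t by (auto simp: dist_real_def)
  next
    case False
    then show ?thesis using admissible_WalkD(3,4)[OF assms, of t s] that t by (auto simp: dist_real_def)
  qed
  then show "\<exists>d'>0. \<forall>s\<in>{0..d}. dist s t < d' \<longrightarrow> dist (g s) (g t) < e"
    using t by blast
qed

lemma walk_zero_Inf:
  assumes "admissible (Walk g d)" "\<exists>r\<in>{0..d}. y + \<sigma> * g r = 0"
  shows "Inf {r \<in> {0..d}. y + \<sigma> * g r = 0} \<in> {r \<in> {0..d}. y + \<sigma> * g r = 0}"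
    "\<And>r. r \<in> {0..d} \<Longrightarrow> y + \<sigma> * g r = 0 \<Longrightarrow> Inf {r \<in> {0..d}. y + \<sigma> * g r = 0} \<le> r"
proof -
  let ?Z = "{r \<in> {0..d}. y + \<sigma> * g r = 0}"
  have bd: "bdd_below ?Z" by (rule bdd_belowI[of _ 0]) auto
  have c: "continuous_on {0..d} (\<lambda>r. y + \<sigma> * g r)"
    by (intro continuous_intros admissible_continuous assms)
  have "closed ?Z"
    using continuous_closed_preimage_constant[OF c, of 0] by auto
  then show "Inf ?Z \<in> ?Z"
    using closed_contains_Inf[of ?Z] assms(2) bd by blast
  show "Inf ?Z \<le> r" if "r \<in> {0..d}" "y + \<sigma> * g r = 0" for r
    using that bd by (intro cInf_lower) auto
qed

lemma walk_duration_bounds: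
  assumes "admissible (Walk g d)"
  shows "0 \<le> walk_duration y \<sigma> g d" "walk_duration y \<sigma> g d \<le> d"
  using walk_zero_Inf(1)[OF assms, of y \<sigma>] admissible_WalkD(1)[OF assms]
  unfolding walk_duration_def by auto

lemma dur_nonneg: "admissible a \<Longrightarrow> 0 \<le> dur a s"
  by (cases a; cases s) (auto simp: walk_duration_bounds)

lemma clock_nonneg:
  assumes "\<And>h. admissible (A h)"
  shows "0 \<le> clock (run A \<omega> n)"
  by (induction n) (auto simp: init_def step_simps dur_nonneg assms)

lemma visits_iff:
  "visits A \<omega> x t \<longleftrightarrow> (\<exists>n g d r. A (hist (run A \<omega> n)) = Walk g d \<and> t = clock (run A \<omega> n) + r \<and>
    0 \<le> r \<and> r \<le> walk_duration (pos (run A \<omega> n)) (dir (run A \<omega> n)) g d \<and>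
    x = pos (run A \<omega> n) + dir (run A \<omega> n) * g r)"
  unfolding visits_def by blast

definition step_hit :: "agent \<Rightarrow> bool stream \<times> real stream \<Rightarrow> real \<Rightarrow> nat \<Rightarrow> ennreal" where
  "step_hit A \<omega> x n = ennreal (clock (run A \<omega> n)) + hit x (A (hist (run A \<omega> n))) (phys_of (run A \<omega> n))"

lemma reach_time_INF_step_hit:
  assumes "\<And>h. admissible (A h)"
  shows "reach_time A x \<omega> = (INF n. step_hit A \<omega> x n)"
proof (rule antisym)
  show "reach_time A x \<omega> \<le> (INF n. step_hit A \<omega> x n)"
  proof (rule INF_greatest)
    fix n
    let ?s = "run A \<omega> n"
    show "reach_time A x \<omega> \<le> step_hit A \<omega> x n"
    proof (cases "A (hist ?s)")
      case (Walk g d)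
      let ?R = "{r. 0 \<le> r \<and> r \<le> walk_duration (pos ?s) (dir ?s) g d \<and> x = pos ?s + dir ?s * g r}"
      have eq: "step_hit A \<omega> x n = ennreal (clock ?s) + (INF r\<in>?R. ennreal r)"
        using Walk by (simp add: step_hit_def phys_of_def)
      have "reach_time A x \<omega> - ennreal (clock ?s) \<le> (INF r\<in>?R. ennreal r)"
      proof (rule INF_greatest)
        fix r assume r: "r \<in> ?R"
        then have "visits A \<omega> x (clock ?s + r)"
          using Walk unfolding visits_iff by blast
        then have "reach_time A x \<omega> \<le> ennreal (clock ?s + r)"
          unfolding reach_time_def by (intro INF_lower) auto
        then show "reach_time A x \<omega> - ennreal (clock ?s) \<le> ennreal r"
          using r clock_nonneg[where A = A and \<omega> = \<omega> and n = n, OF assms] by (simp add: ennreal_minus_le_iff ennreal_plus)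
      qed
      then show ?thesis unfolding eq by (simp add: ennreal_minus_le_iff)
    qed (auto simp: step_hit_def phys_of_def)
  qed
  show "(INF n. step_hit A \<omega> x n) \<le> reach_time A x \<omega>"
    unfolding reach_time_def
  proof (rule INF_greatest)
    fix t assume "t \<in> {t. visits A \<omega> x t}"
    then obtain n g d r where 1: "A (hist (run A \<omega> n)) = Walk g d" "t = clock (run A \<omega> n) + r"
      "0 \<le> r" "r \<le> walk_duration (pos (run A \<omega> n)) (dir (run A \<omega> n)) g d"
      "x = pos (run A \<omega> n) + dir (run A \<omega> n) * g r"
      unfolding visits_iff by blast
    have "(INF n. step_hit A \<omega> x n) \<le> step_hit A \<omega> x n" by (rule INF_lower) simp
    also have "\<dots> \<le> ennreal (clock (run A \<omega> n)) + ennreal r"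
      unfolding step_hit_def phys_of_def 1(1) hit.simps
      by (intro add_left_mono INF_lower) (use 1 in auto)
    also have "\<dots> = ennreal t"
      using 1 clock_nonneg[where A = A and \<omega> = \<omega> and n = n, OF assms] by (simp add: ennreal_plus)
    finally show "(INF n. step_hit A \<omega> x n) \<le> ennreal t" .
  qed
qed

text \<open>The link between the two recursions: after \<open>k\<close> steps the residual agent is
  \<open>A\<close> with the history so far prepended. Starting at an arbitrary \<open>k\<close> is
  what lets the induction on \<open>n\<close> go through.\<close>

lemma rt_along_run:
  assumes "\<And>h. admissible (A h)"
  shows "ennreal (clock (run A \<omega> k)) + rt x n (\<lambda>h. A (hist (run A \<omega> k) @ h)) (sdrop k (snd \<omega>))
      (phys_of (run A \<omega> k)) (sdrop k (fst \<omega>)) = (INF i\<in>{k..<k+n}. step_hit A \<omega> x i)"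
proof (induction n arbitrary: k)
  case (Suc n)
  let ?s = "run A \<omega> k"
  have split: "{k..<k + Suc n} = insert k {Suc k..<Suc k + n}" by auto
  have aft: "after (\<lambda>h. A (hist ?s @ h)) (observe (A (hist ?s)) (snd \<omega> !! k) (phys_of ?s))
    = (\<lambda>h. A (hist (run A \<omega> (Suc k)) @ h))"
    by (simp add: after_def step_simps)
  have cl: "ennreal (clock (run A \<omega> (Suc k))) = ennreal (clock ?s) + ennreal (dur (A (hist ?s)) (phys_of ?s))"
    using clock_nonneg[where A = A, OF assms] dur_nonneg[OF assms] by (simp add: step_simps ennreal_plus)
  have mn: "a + min u w = min (a + u) (a + w)" for a u w :: ennreal
    by (auto simp: min_def intro: add_left_mono antisym)
  have "(INF i\<in>{k..<k + Suc n}. step_hit A \<omega> x i) =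
    min (step_hit A \<omega> x k) (INF i\<in>{Suc k..<Suc k + n}. step_hit A \<omega> x i)"
    unfolding split by (simp add: inf_min)
  also have "\<dots> = min (ennreal (clock ?s) + hit x (A (hist ?s)) (phys_of ?s))
    (ennreal (clock ?s) + (ennreal (dur (A (hist ?s)) (phys_of ?s)) +
      rt x n (\<lambda>h. A (hist (run A \<omega> (Suc k)) @ h)) (sdrop (Suc k) (snd \<omega>))
      (phys_of (run A \<omega> (Suc k))) (sdrop (Suc k) (fst \<omega>))))"
    unfolding Suc.IH[of "Suc k", symmetric] unfolding cl step_hit_def by (simp only: add.assoc)
  finally have *: "(INF i\<in>{k..<k + Suc n}. step_hit A \<omega> x i) = \<dots>" .
  show ?case
    unfolding * mn[symmetric] rt.simps(2) sdrop_simps append_Nil2 aft[symmetric] by (simp add: step_simps(1))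
qed simp

lemma reach_time_eq_reach:
  assumes "\<And>h. admissible (A h)"
  shows "reach_time A x (b, v) = reach x A v (0, 1, False) b"
proof -
  have "rt x n A v (0, 1, False) b = (INF i\<in>{0..<n}. step_hit A (b, v) x i)" for n
    using rt_along_run[where A = A and \<omega> = "(b, v)" and k = 0 and x = x and n = n, OF assms]
    by (simp add: init_def phys_of_def)
  then have "reach x A v (0, 1, False) b = (INF n. INF i\<in>{0..<n}. step_hit A (b, v) x i)"
    by (simp add: reach_def)
  also have "\<dots> = (INF n. step_hit A (b, v) x n)"
  proof (rule antisym)
    show "(INF n. INF i\<in>{0..<n}. step_hit A (b, v) x i) \<le> (INF n. step_hit A (b, v) x n)"
    proof (rule INF_greatest)
      show "(INF n. INF i\<in>{0..<n}. step_hit A (b, v) x i) \<le> step_hit A (b, v) x n" for n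
        by (rule INF_lower2[of "Suc n"]) (auto intro: INF_lower)
    qed
    show "(INF n. step_hit A (b, v) x n) \<le> (INF n. INF i\<in>{0..<n}. step_hit A (b, v) x i)"
      by (intro INF_greatest INF_lower) simp
  qed
  finally show ?thesis using reach_time_INF_step_hit[where A = A, OF assms] by simp
qed

lemma decseq_rt: "decseq (\<lambda>n. rt x n A v s b)"
proof -
  have "rt x (Suc n) A v s b \<le> rt x n A v s b" for n
  proof (induction n arbitrary: A v s b)
    case (Suc n)
    show ?case
      by (subst (1 2) rt.simps(2)) (intro min.mono order_refl add_left_mono Suc.IH)
  qed simp
  then show ?thesis by (rule decseq_SucI)
qed

lemma reach_unfold:
  "reach x A v s b = min (hit x (A []) s) (ennreal (dur (A []) s) +
     reach x (after A (observe (A []) (shd v) s)) (stl v) (move (A []) (shd b) s) (stl b))"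
proof -
  let ?r = "\<lambda>n. rt x n (after A (observe (A []) (shd v) s)) (stl v) (move (A []) (shd b) s) (stl b)"
  have lim: "(\<lambda>n. rt x n B w t c) \<longlonglongrightarrow> reach x B w t c" for B w t c
    unfolding reach_def by (rule LIMSEQ_INF[OF decseq_rt])
  have "(\<lambda>n. rt x (Suc n) A v s b) \<longlonglongrightarrow> reach x A v s b"
    using lim by (rule LIMSEQ_Suc)
  moreover have "(\<lambda>n. min (hit x (A []) s) (ennreal (dur (A []) s) + ?r n)) \<longlonglongrightarrow>
    min (hit x (A []) s) (ennreal (dur (A []) s) +
     reach x (after A (observe (A []) (shd v) s)) (stl v) (move (A []) (shd b) s) (stl b))"
    by (intro tendsto_intros lim)
  ultimately show ?thesis
    unfolding rt.simps(2) by (rule LIMSEQ_unique)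
qed

text \<open>Paths are continuous, so a target is not reached before the targets between it and the origin.\<close>

lemma visits_earlier:
  assumes adm: "\<And>h. admissible (A h)" and "visits A \<omega> z t" and "\<bar>x\<bar> \<le> \<bar>z\<bar>" and "0 < x * z"
  shows "\<exists>t'\<le>t. visits A \<omega> x t'"
proof -
  \<comment> \<open>Multiplying positions by this sign reduces targets on either side of the origin
    to positive ones.\<close>
  define q where "q = sgn z"
  have q: "q * q = 1" "0 < q * x" "q * x \<le> q * z" "\<bar>q\<bar> = 1"
    using assms(3,4) by (auto simp: q_def sgn_real_def zero_less_mult_iff split: if_splits)
  have step: "\<exists>r'\<in>{0..r}. x = pos s + dir s * g r'"
    if "s = run A \<omega> n" "A (hist s) = Walk g d" "0 \<le> r" "r \<le> d"
      "q * pos s < q * x" "q * x \<le> q * (pos s + dir s * g r)" for s n g d r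
  proof -
    have ad: "admissible (Walk g d)" using adm that(2) by metis
    have "continuous_on {0..r} (\<lambda>r. q * (pos s + dir s * g r))"
      using admissible_continuous[OF ad] that(4)
      by (intro continuous_intros) (auto elim: continuous_on_subset)
    then have "\<exists>r'\<ge>0. r' \<le> r \<and> q * (pos s + dir s * g r') = q * x"
      using that admissible_WalkD(2)[OF ad] by (intro IVT') auto
    then show ?thesis using q(1) by (metis atLeastAtMost_iff mult.assoc mult_1)
  qed
  \<comment> \<open>Until \<open>x\<close> has been visited, the position at the end of each step is
    strictly on the near side of \<open>x\<close>; otherwise the intermediate value theorem yields a
    visit during the step.\<close>
  have inv: "q * pos (run A \<omega> n) < q * x \<or> (\<exists>t'\<le>clock (run A \<omega> n). visits A \<omega> x t')" for n
  proof (induction n)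
    case 0
    then show ?case using q by (simp add: init_def)
  next
    case (Suc n)
    let ?s = "run A \<omega> n"
    have cl: "clock (run A \<omega> (Suc n)) = clock ?s + dur (A (hist ?s)) (phys_of ?s)"
      by (simp add: step_simps)
    show ?case
    proof (cases "\<exists>t'\<le>clock ?s. visits A \<omega> x t'")
      case True
      then show ?thesis using cl dur_nonneg[OF adm, of "hist ?s" "phys_of ?s"] by force
    next
      case False
      then have lt: "q * pos ?s < q * x" using Suc by blast
      have ph: "phys_of (run A \<omega> (Suc n)) = move (A (hist ?s)) (fst \<omega> !! n) (phys_of ?s)"
        by (simp add: step_simps)
      show ?thesis
      proof (cases "A (hist ?s)")
        case (Walk g d)
        let ?r = "walk_duration (pos ?s) (dir ?s) g d"
        have ad: "admissible (Walk g d)" using adm Walk by metis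
        have p: "pos (run A \<omega> (Suc n)) = pos ?s + dir ?s * g ?r"
          using ph Walk by (simp add: phys_of_def)
        show ?thesis
        proof (rule disjCI)
          assume no: "\<not> (\<exists>t'\<le>clock (run A \<omega> (Suc n)). visits A \<omega> x t')"
          show "q * pos (run A \<omega> (Suc n)) < q * x"
          proof (rule ccontr)
            assume "\<not> q * pos (run A \<omega> (Suc n)) < q * x"
            then obtain r' where r': "r' \<in> {0..?r}" "x = pos ?s + dir ?s * g r'"
              using step[OF refl Walk, of ?r] lt walk_duration_bounds[OF ad] p by (metis linorder_not_less)
            then have "visits A \<omega> x (clock ?s + r')"
              unfolding visits_iff using Walk by auto
            moreover have "clock ?s + r' \<le> clock (run A \<omega> (Suc n))"
              using r' cl Walk by (simp add: phys_of_def)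
            ultimately show False using no by blast
          qed
        qed
      qed (use ph lt in \<open>auto simp: phys_of_def\<close>)
    qed
  qed
  obtain n g d r where v: "A (hist (run A \<omega> n)) = Walk g d" "t = clock (run A \<omega> n) + r"
      "0 \<le> r" "r \<le> walk_duration (pos (run A \<omega> n)) (dir (run A \<omega> n)) g d"
      "z = pos (run A \<omega> n) + dir (run A \<omega> n) * g r"
    using assms(2) unfolding visits_iff by blast
  have ad: "admissible (Walk g d)" using adm v(1) by metis
  show ?thesis
  proof (cases "\<exists>t'\<le>clock (run A \<omega> n). visits A \<omega> x t'")
    case True
    moreover have "clock (run A \<omega> n) \<le> t" using v by simp
    ultimately show ?thesis by (meson order_trans)
  next
    case False
    then have "q * pos (run A \<omega> n) < q * x" using inv by blast
    moreover have "r \<le> d" using v(4) walk_duration_bounds(2)[OF ad] by (meson order_trans)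
    moreover have "q * x \<le> q * (pos (run A \<omega> n) + dir (run A \<omega> n) * g r)"
      using q v(5) by simp
    ultimately obtain r' where r': "r' \<in> {0..r}" "x = pos (run A \<omega> n) + dir (run A \<omega> n) * g r'"
      using step[OF refl v(1,3)] by blast
    then have "visits A \<omega> x (clock (run A \<omega> n) + r')"
      unfolding visits_iff using v by force
    then show ?thesis using r' v by (intro exI[of _ "clock (run A \<omega> n) + r'"]) auto
  qed
qed

lemma reach_time_mono:
  assumes "\<And>h. admissible (A h)" and "\<bar>x\<bar> \<le> \<bar>z\<bar>" and "0 < x * z"
  shows "reach_time A x \<omega> \<le> reach_time A z \<omega>"
  unfolding reach_time_def
proof (rule INF_greatest)
  fix t assume "t \<in> {t. visits A \<omega> z t}"
  then obtain t' where "t' \<le> t" "visits A \<omega> x t'"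
    using visits_earlier[where A = A, OF assms(1) _ assms(2,3)] by blast
  then show "(INF t\<in>{t. visits A \<omega> x t}. ennreal t) \<le> ennreal t"
    by (intro INF_lower2[of t']) (auto intro: ennreal_leI)
qed

section \<open>Expectation over the faults\<close>

locale faulty =
  fixes p :: real
  assumes p_pos: "0 < p" and p_less_half: "p < 1 / 2"
begin

definition faults :: "bool stream measure" where
  "faults = stream_space (measure_pmf (bernoulli_pmf p))"

sublocale faults: prob_space faults
  unfolding faults_def by (rule prob_space.prob_space_stream_space[OF prob_space_measure_pmf])

lemma sets_faults [measurable_cong]: "sets faults = sets (stream_space (count_space UNIV))"
  unfolding faults_def by (rule sets_stream_space_cong) simp

definition EB :: "(bool stream \<Rightarrow> real) \<Rightarrow> real" where
  "EB f = (\<integral>b. f b \<partial>faults)"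

abbreviation Fmeas :: "(bool stream \<Rightarrow> real) \<Rightarrow> bool" where
  "Fmeas f \<equiv> f \<in> borel_measurable faults"

lemma integrable_faults:
  assumes "Fmeas f" "\<And>b. 0 \<le> f b" "\<And>b. f b \<le> M"
  shows "integrable faults f"
  by (rule faults.integrable_const_bound[where B = M]) (use assms in auto)

lemma ennreal_EB:
  assumes "Fmeas f" "\<And>b. 0 \<le> f b" "\<And>b. f b \<le> M"
  shows "ennreal (EB f) = (\<integral>\<^sup>+b. ennreal (f b) \<partial>faults)"
  unfolding EB_def by (rule nn_integral_eq_integral[symmetric]) (use integrable_faults[OF assms] assms in auto)

lemma EB_nonneg: "(\<And>b. 0 \<le> f b) \<Longrightarrow> 0 \<le> EB f"
  unfolding EB_def by (rule Bochner_Integration.integral_nonneg)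

lemma EB_const [simp]: "EB (\<lambda>_. c) = c"
  unfolding EB_def by (simp add: faults.prob_space)

lemma EB_mono:
  assumes "Fmeas f" "Fmeas g" "\<And>b. 0 \<le> f b" "\<And>b. f b \<le> g b" "\<And>b. g b \<le> M"
  shows "EB f \<le> EB g"
  unfolding EB_def
  by (intro integral_mono integrable_faults[where M = M]) (use assms in \<open>auto intro: order_trans\<close>)

lemma Stream_measurable_faults: "(\<lambda>b. c ## b) \<in> measurable faults faults"
  by measurable

lemma Fmeas_Stream: "f \<in> measurable faults N \<Longrightarrow> (\<lambda>b. f (c ## b)) \<in> measurable faults N"
  by (rule measurable_compose[OF Stream_measurable_faults])

lemma EB_unfold:
  assumes [measurable]: "Fmeas f" and "\<And>b. 0 \<le> f b" "\<And>b. f b \<le> M"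
  shows "EB f = p * EB (\<lambda>b. f (True ## b)) + (1 - p) * EB (\<lambda>b. f (False ## b))"
proof -
  have "ennreal (EB f) = (\<integral>\<^sup>+c. \<integral>\<^sup>+b. ennreal (f (c ## b)) \<partial>faults \<partial>measure_pmf (bernoulli_pmf p))"
    unfolding ennreal_EB[OF assms] unfolding faults_def
    by (rule prob_space.nn_integral_stream_space[OF prob_space_measure_pmf]) (simp flip: faults_def)
  also have "\<dots> = (\<integral>\<^sup>+c. ennreal (EB (\<lambda>b. f (c ## b))) \<partial>measure_pmf (bernoulli_pmf p))"
    by (subst ennreal_EB[where M = M]) (auto simp: assms intro!: Fmeas_Stream)
  also have "\<dots> = ennreal (p * EB (\<lambda>b. f (True ## b)) + (1 - p) * EB (\<lambda>b. f (False ## b)))"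
    using p_pos p_less_half EB_nonneg assms(2)
    by (subst nn_integral_bernoulli_pmf) (auto simp: ennreal_mult' ennreal_plus mult.commute)
  finally show ?thesis
    using p_pos p_less_half EB_nonneg assms(2) by (subst (asm) ennreal_inj) auto
qed

lemma rt_measurable [measurable]: "(\<lambda>b. rt x n A v s b) \<in> borel_measurable faults"
proof (induction n arbitrary: A v s)
  case (Suc n)
  let ?a = "after A (observe (A []) (shd v) s)"
  note [measurable] = Suc
  have stl: "(\<lambda>b. rt x n B w t (stl b)) \<in> borel_measurable faults" for B w t
    by (rule measurable_compose[OF _ Suc]) measurable
  \<comment> \<open>The first fault enters only through a case distinction with two outcomes, which
    is measurable whatever the agent does.\<close>
  have "(\<lambda>b. rt x (Suc n) A v s b) = (\<lambda>b. if shd b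
    then min (hit x (A []) s) (ennreal (dur (A []) s) + rt x n ?a (stl v) (move (A []) True s) (stl b))
    else min (hit x (A []) s) (ennreal (dur (A []) s) + rt x n ?a (stl v) (move (A []) False s) (stl b)))"
    by (auto simp: fun_eq_iff)
  also have "\<dots> \<in> borel_measurable faults"
    using stl by measurable
  finally show ?case .
next
  case 0
  have "(\<lambda>b. rt x 0 A v s b) = (\<lambda>_. \<infinity>)" by simp
  then show ?case by simp
qed

lemma reach_measurable [measurable]: "(\<lambda>b. reach x A v s b) \<in> borel_measurable faults"
  unfolding reach_def by measurable

text \<open>Besides cutting off at the constant \<open>M\<close>, this also serves with a deadline
  \<open>S\<close> as bound, where it is the time that a simulation with that deadline spends on the
  target.\<close>

definition trunc :: "real \<Rightarrow> ennreal \<Rightarrow> real" where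
  "trunc M t = enn2real (min (ennreal M) t)"

lemma trunc_measurable [measurable]: "trunc M \<in> borel_measurable borel"
  unfolding trunc_def by measurable

lemma trunc_bounds: "0 \<le> M \<Longrightarrow> 0 \<le> trunc M t" "0 \<le> M \<Longrightarrow> trunc M t \<le> M"
  unfolding trunc_def by (auto intro!: enn2real_leI)

lemma ennreal_trunc: "0 \<le> M \<Longrightarrow> ennreal (trunc M t) = min (ennreal M) t"
  unfolding trunc_def by (intro ennreal_enn2real) (auto simp: min_less_iff_disj)

lemma trunc_leI: "t \<le> ennreal c \<Longrightarrow> 0 \<le> c \<Longrightarrow> trunc M t \<le> c"
  unfolding trunc_def by (rule enn2real_leI) (auto intro: min.coboundedI2)

lemma trunc_mono: "0 \<le> M \<Longrightarrow> t \<le> u \<Longrightarrow> trunc M t \<le> trunc M u"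
  unfolding trunc_def by (rule enn2real_mono) (auto intro: min.coboundedI2 simp: min_less_iff_disj)

lemma trunc_add_le:
  assumes "0 \<le> M" "0 \<le> d"
  shows "trunc M (ennreal d + t) \<le> d + trunc M t"
proof -
  have "ennreal (trunc M (ennreal d + t)) \<le> ennreal (d + trunc M t)"
    using assms by (auto simp: ennreal_plus ennreal_trunc trunc_bounds min_def add_increasing)
  then show ?thesis using assms trunc_bounds(1)[of M t] by (subst (asm) ennreal_le_iff) auto
qed

text \<open>Every step uses up one fault, but only a turn attempt looks at it. For other steps the
  comparison of \<open>f\<close> after the step with \<open>g\<close> holds for both values of the
  discarded fault \<open>c\<close>.\<close>

lemma EB_shift_le:
  assumes [measurable]: "Fmeas f" "Fmeas g" and "\<And>b. 0 \<le> f b" "\<And>b. 0 \<le> g b" "\<And>b. g b \<le> M"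
    and le: "\<And>c b. f (c ## b) \<le> d + g b" and d: "0 \<le> d"
  shows "EB f \<le> d + EB g"
proof -
  have f: "f b \<le> d + M" for b
    using le[of "shd b" "stl b"] assms(5)[of "stl b"] by simp
  have gi: "integrable faults g"
    by (rule integrable_faults) (use assms in auto)
  have "EB (\<lambda>b. f (c ## b)) \<le> EB (\<lambda>b. d + g b)" for c
    by (rule EB_mono[where M = "d + M"]) (use assms in \<open>auto intro!: Fmeas_Stream\<close>)
  also have "EB (\<lambda>b. d + g b) = d + EB g"
    using gi unfolding EB_def by (simp add: faults.prob_space)
  finally have *: "EB (\<lambda>b. f (c ## b)) \<le> d + EB g" for c .
  have "EB f \<le> p * (d + EB g) + (1 - p) * (d + EB g)"
    unfolding EB_unfold[OF assms(1,3) f]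
    by (intro add_mono mult_left_mono *) (use p_pos p_less_half in auto)
  then show ?thesis by (simp add: algebra_simps)
qed

lemma EB_shift_eq:
  assumes [measurable]: "Fmeas f" "Fmeas g" and "\<And>b. 0 \<le> f b" "\<And>b. 0 \<le> g b" "\<And>b. g b \<le> M"
    and eq: "\<And>c b. f (c ## b) = d + g b"
  shows "EB f = d + EB g"
proof -
  have f: "f b \<le> d + M" for b
    using eq[of "shd b" "stl b"] assms(5)[of "stl b"] by simp
  have "integrable faults g"
    by (rule integrable_faults) (use assms in auto)
  then have "EB (\<lambda>b. d + g b) = d + EB g"
    unfolding EB_def by (simp add: faults.prob_space)
  then show ?thesis
    unfolding EB_unfold[OF assms(1,3) f] eq by (simp add: algebra_simps)
qed

text \<open>The stream \<open>sconst 0\<close> is a dummy: the value is used for agents that never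
  query, and their reaching times do not depend on the answers.\<close>

definition val :: "real \<Rightarrow> real \<Rightarrow> agent \<Rightarrow> phys \<Rightarrow> real" where
  "val x M B s = EB (\<lambda>b. trunc M (reach x B (sconst 0) s b))"

lemma val_nonneg: "0 \<le> M \<Longrightarrow> 0 \<le> val x M B s"
  unfolding val_def by (intro EB_nonneg trunc_bounds)

lemma val_le: "0 \<le> M \<Longrightarrow> val x M B s \<le> M"
  unfolding val_def using EB_mono[of "\<lambda>b. trunc M (reach x B (sconst 0) s b)" "\<lambda>_. M" M]
  by (auto simp: trunc_bounds)

lemma val_hit:
  assumes "0 \<le> M" "hit x (B []) s \<le> ennreal t" "0 \<le> t"
  shows "val x M B s \<le> t"
proof -
  have "trunc M (reach x B (sconst 0) s b) \<le> t" for b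
    using assms by (intro trunc_leI) (auto simp: reach_unfold[of x B] min.coboundedI1)
  then show ?thesis
    unfolding val_def using EB_mono[of "\<lambda>b. trunc M (reach x B (sconst 0) s b)" "\<lambda>_. t" t] assms
    by (auto simp: trunc_bounds)
qed

text \<open>Only an upper bound, because a hit of the target during the walk is ignored. This is
  enough wherever an agent merely travels.\<close>

lemma val_Walk:
  assumes "0 \<le> M" "B [] = Walk g d" "admissible (Walk g d)"
    and "r = walk_duration y \<sigma> g d"
  shows "val x M B (y, \<sigma>, m) \<le>
    r + val x M (after B (Walked r (y + \<sigma> * g r = 0))) (y + \<sigma> * g r, \<sigma>, m \<or> g r > 0)"
  unfolding val_def
proof (rule EB_shift_le[where M = M])
  show d: "0 \<le> r" using assms walk_duration_bounds by auto
  fix c b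
  let ?t = "reach x (after B (Walked r (y + \<sigma> * g r = 0))) (sconst 0) (y + \<sigma> * g r, \<sigma>, m \<or> g r > 0) b"
  have "reach x B (sconst 0) (y, \<sigma>, m) (c ## b) \<le> ennreal r + ?t"
    using assms by (subst reach_unfold) auto
  then have "trunc M (reach x B (sconst 0) (y, \<sigma>, m) (c ## b)) \<le> trunc M (ennreal r + ?t)"
    using assms by (intro trunc_mono)
  also have "\<dots> \<le> r + trunc M ?t" using assms(1) d by (rule trunc_add_le)
  finally show "trunc M (reach x B (sconst 0) (y, \<sigma>, m) (c ## b)) \<le> r + trunc M ?t" .
qed (auto simp: trunc_bounds assms(1))

lemma val_Turn:
  assumes "0 \<le> M" "B [] = Turn"
  shows "val x M B (y, \<sigma>, True) =
    p * val x M (after B Silent) (y, \<sigma>, True) + (1 - p) * val x M (after B Silent) (y, - \<sigma>, True)"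
proof -
  have "reach x B (sconst 0) (y, \<sigma>, True) (c ## b) =
    reach x (after B Silent) (sconst 0) (y, if c then \<sigma> else - \<sigma>, True) b" for c b
    using assms by (subst reach_unfold) auto
  then show ?thesis
    unfolding val_def by (subst EB_unfold[where M = M]) (auto simp: trunc_bounds assms(1))
qed

section \<open>Returning to the origin\<close>

definition at_origin :: "observation \<Rightarrow> bool" where
  "at_origin z \<longleftrightarrow> (\<exists>r. z = Walked r True)"

text \<open>Meant for a start facing away from the origin at distance at most \<open>D\<close>.
  After the attempted turn, a walk of length \<open>D\<close> meets the origin exactly if the
  attempt succeeded. Otherwise the agent still faces away, now at distance at most
  \<open>2 * D\<close>, so the same situation recurs at twice the scale.\<close>

fun homing :: "real \<Rightarrow> agent \<Rightarrow> agent" where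
  "homing D K [] = Turn"
| "homing D K [z] = Walk (\<lambda>t. t) D"
| "homing D K (z # w # h) = (if at_origin w then K h else homing (2 * D) K h)"

text \<open>For a start at distance at most \<open>D\<close> when it is unknown whether the agent
  faces the origin. One walk of length \<open>D\<close> either reaches it or shows that the agent
  faces away, which is the situation of \<open>homing\<close>.\<close>

fun homing_blind :: "real \<Rightarrow> agent \<Rightarrow> agent" where
  "homing_blind D K [] = Walk (\<lambda>t. t) D"
| "homing_blind D K (w # h) = (if at_origin w then K h else homing (2 * D) K h)"

text \<open>The bit passed to \<open>K\<close> is \<open>True\<close> exactly if the turn attempt
  failed. In both cases the agent comes back facing the direction opposite to the one in which it
  left, so the bit and the direction on return are unrelated, and an excursion with ignored bit is a
  turn that is certain to succeed.\<close>

fun excursion :: "real \<Rightarrow> (bool \<Rightarrow> agent) \<Rightarrow> agent" where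
  "excursion D K [] = Walk (\<lambda>t. t) D"
| "excursion D K [z] = Turn"
| "excursion D K [z, w] = Walk (\<lambda>t. t) D"
| "excursion D K (z # w # u # h) = (if at_origin u then K False h else homing (2 * D) (K True) h)"

primrec bits :: "nat \<Rightarrow> real \<Rightarrow> (bool list \<Rightarrow> agent) \<Rightarrow> agent" where
  "bits 0 D K = K []"
| "bits (Suc n) D K = excursion D (\<lambda>c. bits n D (\<lambda>bs. K (c # bs)))"

lemma admissible_id: "0 \<le> D \<Longrightarrow> admissible (Walk (\<lambda>t. t) D)"
  by (auto simp: admissible_def)

text \<open>The solution of \<open>C = 1 + 2 * p * C\<close>: a round of \<open>homing\<close> costs
  at most \<open>D\<close>, and with probability \<open>p\<close> the task recurs at scale
  \<open>2 * D\<close>. It is finite and positive because \<open>p < 1 / 2\<close>.\<close>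

definition C :: real where "C = 1 / (1 - 2 * p)"

lemma C_props: "1 \<le> C" "1 + 2 * p * C = C"
  using p_pos p_less_half unfolding C_def by (auto simp: field_simps)

lemma walk_duration_away:
  assumes "\<sigma> * y \<ge> 0" "\<sigma> = 1 \<or> \<sigma> = -1"
  shows "walk_duration y \<sigma> (\<lambda>t. t) D = D"
  using assms unfolding walk_duration_def by auto

lemma walk_duration_back:
  assumes "\<sigma> * y < 0" "\<sigma> = 1 \<or> \<sigma> = -1" "\<bar>y\<bar> \<le> D"
  shows "walk_duration y \<sigma> (\<lambda>t. t) D = \<bar>y\<bar>"
proof -
  have eq: "{r \<in> {0..D}. y + \<sigma> * r = 0} = {\<bar>y\<bar>}"
    using assms by auto
  then have ex: "\<exists>r\<in>{0..D}. y + \<sigma> * r = 0" by blast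
  show ?thesis using assms ex unfolding walk_duration_def eq by auto
qed

lemma val_walk_away:
  assumes "0 \<le> M" "B [] = Walk (\<lambda>t. t) D" "0 < D" "\<sigma> * y \<ge> 0" "\<sigma> = 1 \<or> \<sigma> = -1"
  shows "val x M B (y, \<sigma>, m) \<le> D + val x M (after B (Walked D False)) (y + \<sigma> * D, \<sigma>, True)"
proof -
  have "y + \<sigma> * D \<noteq> 0" using assms by auto
  then show ?thesis
    using val_Walk[where B = B, OF assms(1,2) admissible_id refl, where y = y and \<sigma> = \<sigma> and x = x and m = m] walk_duration_away[OF assms(4,5), of D] assms
    by simp
qed

lemma val_walk_back:
  assumes "0 \<le> M" "B [] = Walk (\<lambda>t. t) D" "\<sigma> * y < 0" "\<sigma> = 1 \<or> \<sigma> = -1" "\<bar>y\<bar> \<le> D"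
  shows "val x M B (y, \<sigma>, m) \<le> \<bar>y\<bar> + val x M (after B (Walked \<bar>y\<bar> True)) (0, \<sigma>, True)"
proof -
  have "y + \<sigma> * \<bar>y\<bar> = 0" "\<bar>y\<bar> > 0" using assms by auto
  then show ?thesis
    using val_Walk[where B = B, OF assms(1,2) admissible_id refl, where y = y and \<sigma> = \<sigma> and x = x and m = m] walk_duration_back[OF assms(3-5)] assms
    by simp
qed

lemma after_homing:
  "after (homing D K) z [] = Walk (\<lambda>t. t) D"
  "after (after (homing D K) z) w = (if at_origin w then K else homing (2 * D) K)"
  by (auto simp: after_def fun_eq_iff)

lemma after_homing_blind:
  "after (homing_blind D K) w = (if at_origin w then K else homing (2 * D) K)"
  by (auto simp: after_def fun_eq_iff)

lemma after_excursion:
  "after (excursion D K) z [] = Turn"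
  "after (after (excursion D K) z) w [] = Walk (\<lambda>t. t) D"
  "after (after (after (excursion D K) z) w) u = (if at_origin u then K False else homing (2 * D) (K True))"
  by (auto simp: after_def fun_eq_iff)

lemma at_origin_Walked [simp]: "at_origin (Walked r q) = q"
  by (auto simp: at_origin_def)

text \<open>A successful turn costs at most \<open>D + W\<close>, a failed one \<open>D\<close> plus
  the bound at scale \<open>2 * D\<close>; the average is \<open>(1 + 2 * p * C) * D + W\<close>,
  which is the claim again. The return is always in direction \<open>- \<sigma>\<close>, so
  \<open>W\<close> has to bound \<open>K\<close> for this direction only.\<close>

lemma val_homing:
  assumes M: "0 \<le> M" and \<sigma>: "\<sigma> = 1 \<or> \<sigma> = -1" and W: "val x M K (0, - \<sigma>, True) \<le> W"
    and "0 < D" "0 < \<sigma> * y" "\<bar>y\<bar> \<le> D"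
  shows "val x M (homing D K) (y, \<sigma>, True) \<le> C * D + W"
proof -
  have W0: "0 \<le> W" using W val_nonneg[OF M] by (meson order_trans)
  have *: "val x M (homing D K) (y, \<sigma>, True) \<le> C * D + W + p ^ n * M"
    if "0 < D" "0 < \<sigma> * y" "\<bar>y\<bar> \<le> D" for n D y
    using that
  proof (induction n arbitrary: D y)
    case 0
    then have "0 \<le> C * D" using C_props(1) by simp
    then show ?case using val_le[OF M, of x "homing D K" "(y, \<sigma>, True)"] W0 by simp
  next
    case (Suc n)
    have 1: "val x M (after (homing D K) Silent) (y, \<sigma>, True) \<le> D + (C * (2 * D) + W + p ^ n * M)"
    proof -
      have "val x M (after (homing D K) Silent) (y, \<sigma>, True) \<le> D + val x M (homing (2 * D) K) (y + \<sigma> * D, \<sigma>, True)"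
        using val_walk_away[where B = "after (homing D K) Silent", OF M after_homing(1) Suc.prems(1) _ \<sigma>] Suc.prems
        by (simp add: after_homing)
      also have "val x M (homing (2 * D) K) (y + \<sigma> * D, \<sigma>, True) \<le> C * (2 * D) + W + p ^ n * M"
        by (rule Suc.IH) (use Suc.prems \<sigma> in auto)
      finally show ?thesis by simp
    qed
    have 2: "val x M (after (homing D K) Silent) (y, - \<sigma>, True) \<le> D + W"
    proof -
      have "val x M (after (homing D K) Silent) (y, - \<sigma>, True) \<le> \<bar>y\<bar> + val x M K (0, - \<sigma>, True)"
        using val_walk_back[where B = "after (homing D K) Silent" and \<sigma> = "- \<sigma>" and y = y and m = True and x = x,
          OF M after_homing(1)] Suc.prems \<sigma>
        by (auto simp: after_homing)
      then show ?thesis using W Suc.prems by simp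
    qed
    have "val x M (homing D K) (y, \<sigma>, True) \<le>
      p * (D + (C * (2 * D) + W + p ^ n * M)) + (1 - p) * (D + W)"
      unfolding val_Turn[where B = "homing D K", OF M homing.simps(1)]
      by (intro add_mono mult_left_mono 1 2) (use p_pos p_less_half in auto)
    also have "\<dots> = (1 + 2 * p * C) * D + W + p ^ Suc n * M"
      by (simp add: algebra_simps)
    finally show ?case unfolding C_props(2) .
  qed
  have "(\<lambda>n. C * D + W + p ^ n * M) \<longlonglongrightarrow> C * D + W + 0 * M"
    using p_pos p_less_half by (intro tendsto_intros LIMSEQ_realpow_zero) auto
  from LIMSEQ_le_const[OF this] show ?thesis
    using *[OF assms(4-6)] by auto
qed

text \<open>The constant is one walk of length \<open>D\<close> followed, in the worse case, by
  \<open>homing\<close> at scale \<open>2 * D\<close>. The direction on return now depends on the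
  starting side, hence two assumptions on \<open>K\<close>.\<close>

lemma val_homing_blind:
  assumes M: "0 \<le> M" and \<sigma>: "\<sigma> = 1 \<or> \<sigma> = -1"
    and W: "val x M K (0, \<sigma>, True) \<le> W" "val x M K (0, - \<sigma>, True) \<le> W"
    and "0 < D" "\<bar>y\<bar> \<le> D"
  shows "val x M (homing_blind D K) (y, \<sigma>, True) \<le> (1 + 2 * C) * D + W"
proof (cases "0 \<le> \<sigma> * y")
  case True
  have "val x M (homing_blind D K) (y, \<sigma>, True) \<le> D + val x M (homing (2 * D) K) (y + \<sigma> * D, \<sigma>, True)"
    using val_walk_away[where B = "homing_blind D K", OF M homing_blind.simps(1) assms(5) True \<sigma>]
    by (simp add: after_homing_blind)
  also have "val x M (homing (2 * D) K) (y + \<sigma> * D, \<sigma>, True) \<le> C * (2 * D) + W"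
    by (rule val_homing[OF M \<sigma> W(2)]) (use True \<sigma> assms in \<open>auto\<close>)
  finally show ?thesis by (simp add: algebra_simps)
next
  case False
  then have "val x M (homing_blind D K) (y, \<sigma>, True) \<le> \<bar>y\<bar> + val x M K (0, \<sigma>, True)"
    using val_walk_back[where B = "homing_blind D K", OF M homing_blind.simps(1)] \<sigma> assms
    by (simp add: after_homing_blind)
  moreover have "0 \<le> 2 * C * D" using C_props(1) assms(5) by simp
  ultimately show ?thesis using W assms by (simp add: algebra_simps)
qed

text \<open>The way out and the walk after the turn take \<open>D\<close> each, and a failure adds
  \<open>C * (2 * D)\<close>: altogether \<open>1 + (1 + 2 * p * C) = 1 + C\<close> times
  \<open>D\<close>.\<close>

lemma val_excursion:
  assumes M: "0 \<le> M" and \<sigma>: "\<sigma> = 1 \<or> \<sigma> = -1" and D: "0 < D"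
  shows "val x M (excursion D K) (0, \<sigma>, m) \<le> (1 + C) * D +
    p * val x M (K True) (0, - \<sigma>, True) + (1 - p) * val x M (K False) (0, - \<sigma>, True)"
proof -
  let ?e = "after (excursion D K) (Walked D False)"
  have s: "\<sigma> * (\<sigma> * D) = D" using \<sigma> by auto
  have "val x M (excursion D K) (0, \<sigma>, m) \<le> D + val x M ?e (\<sigma> * D, \<sigma>, True)"
    using val_walk_away[where B = "excursion D K" and y = 0, OF M excursion.simps(1) D _ \<sigma>] by simp
  also have "val x M ?e (\<sigma> * D, \<sigma>, True) =
    p * val x M (after ?e Silent) (\<sigma> * D, \<sigma>, True) + (1 - p) * val x M (after ?e Silent) (\<sigma> * D, - \<sigma>, True)"
    by (rule val_Turn[where B = ?e, OF M after_excursion(1)])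
  also have "\<dots> \<le> p * (D + (C * (2 * D) + val x M (K True) (0, - \<sigma>, True)))
    + (1 - p) * (D + val x M (K False) (0, - \<sigma>, True))"
  proof (intro add_mono mult_left_mono)
    have "val x M (after ?e Silent) (\<sigma> * D, \<sigma>, True) \<le>
      D + val x M (homing (2 * D) (K True)) (\<sigma> * D + \<sigma> * D, \<sigma>, True)"
      using val_walk_away[where B = "after ?e Silent" and y = "\<sigma> * D", OF M after_excursion(2) D _ \<sigma>] s D
      by (simp add: after_excursion)
    also have "val x M (homing (2 * D) (K True)) (\<sigma> * D + \<sigma> * D, \<sigma>, True) \<le>
      C * (2 * D) + val x M (K True) (0, - \<sigma>, True)"
      by (rule val_homing[OF M \<sigma> order_refl]) (use \<sigma> D in \<open>auto\<close>)
    finally show "val x M (after ?e Silent) (\<sigma> * D, \<sigma>, True) \<le>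
      D + (C * (2 * D) + val x M (K True) (0, - \<sigma>, True))" by simp
    have "\<bar>\<sigma> * D\<bar> = D" using \<sigma> D by auto
    then show "val x M (after ?e Silent) (\<sigma> * D, - \<sigma>, True) \<le> D + val x M (K False) (0, - \<sigma>, True)"
      using val_walk_back[where B = "after ?e Silent" and y = "\<sigma> * D" and \<sigma> = "- \<sigma>" and m = True and x = x,
          OF M after_excursion(2)] s D \<sigma>
      by (auto simp: after_excursion)
  qed (use p_pos p_less_half in auto)
  also have "D + (p * (D + (C * (2 * D) + val x M (K True) (0, - \<sigma>, True)))
    + (1 - p) * (D + val x M (K False) (0, - \<sigma>, True))) = (1 + (1 + 2 * p * C)) * D
    + p * val x M (K True) (0, - \<sigma>, True) + (1 - p) * val x M (K False) (0, - \<sigma>, True)"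
    by (simp add: algebra_simps)
  finally show ?thesis unfolding C_props(2) by simp
qed

section \<open>Random bits from the faults\<close>

primrec wt :: "bool list \<Rightarrow> real" where
  "wt [] = 1"
| "wt (c # bs) = (if c then p else 1 - p) * wt bs"

definition words :: "nat \<Rightarrow> bool list set" where
  "words n = {bs. length bs = n}"

lemma words_Suc: "words (Suc n) = (#) True ` words n \<union> (#) False ` words n"
proof -
  have "bs \<in> (#) True ` words n \<union> (#) False ` words n" if "length bs = Suc n" for bs
    using that by (cases bs; cases "hd bs") (auto simp: words_def)
  then show ?thesis by (auto simp: words_def)
qed

lemma words_0: "words 0 = {[]}"
  by (auto simp: words_def)

lemma finite_words [simp]: "finite (words n)"
  by (induction n) (auto simp: words_0 words_Suc)

lemma sum_words_Suc:
  "(\<Sum>bs\<in>words (Suc n). f bs) = (\<Sum>bs\<in>words n. f (True # bs)) + (\<Sum>bs\<in>words n. f (False # bs))"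
  unfolding words_Suc by (subst sum.union_disjoint) (auto simp: sum.reindex)

lemma wt_pos: "0 < wt bs"
  using p_pos p_less_half by (induction bs) auto

lemma sum_wt: "(\<Sum>bs\<in>words n. wt bs) = 1"
  by (induction n) (auto simp: words_0 sum_words_Suc simp flip: sum_distrib_left)

text \<open>This is the probability that two independent words coincide. It controls the variance of
  averages weighted by \<open>wt\<close>; that the bits are biased does not matter as long as it
  tends to 0.\<close>

lemma sum_wt_squared: "(\<Sum>bs\<in>words n. (wt bs)\<^sup>2) = (p\<^sup>2 + (1 - p)\<^sup>2) ^ n"
proof (induction n)
  case (Suc n)
  then show ?case
    by (simp add: sum_words_Suc power_mult_distrib distrib_right flip: sum_distrib_left)
qed (simp add: words_0)

lemma val_bits:
  assumes M: "0 \<le> M" and D: "0 < D" and "\<sigma> = 1 \<or> \<sigma> = -1"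
  shows "val x M (bits n D K) (0, \<sigma>, True) \<le> n * (1 + C) * D +
    (\<Sum>bs\<in>words n. wt bs * val x M (K bs) (0, (-1) ^ n * \<sigma>, True))"
  using assms(3)
proof (induction n arbitrary: K \<sigma>)
  case (Suc n)
  let ?S = "\<lambda>c. \<Sum>bs\<in>words n. wt bs * val x M (K (c # bs)) (0, (-1) ^ Suc n * \<sigma>, True)"
  have 1: "val x M (bits n D (\<lambda>bs. K (c # bs))) (0, - \<sigma>, True) \<le> n * (1 + C) * D + ?S c" for c
    using Suc.IH[of "- \<sigma>" "\<lambda>bs. K (c # bs)"] Suc.prems by auto
  have "val x M (bits (Suc n) D K) (0, \<sigma>, True) \<le> (1 + C) * D +
    p * (n * (1 + C) * D + ?S True) + (1 - p) * (n * (1 + C) * D + ?S False)"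
    unfolding bits.simps
    by (rule order_trans[OF val_excursion[OF M Suc.prems D]], intro add_mono mult_left_mono 1 order_refl)
      (use p_pos p_less_half in auto)
  also have "\<dots> = Suc n * (1 + C) * D + (p * ?S True + (1 - p) * ?S False)"
    by (simp add: algebra_simps)
  also have "p * ?S True + (1 - p) * ?S False =
    (\<Sum>bs\<in>words (Suc n). wt bs * val x M (K bs) (0, (-1) ^ Suc n * \<sigma>, True))"
    by (simp add: sum_words_Suc sum_distrib_left mult.assoc)
  finally show ?case .
qed (simp add: words_0)


section \<open>Simulating an agent for a bounded time\<close>

text \<open>Stands in for an action that a simulation must not copy: a query, or a turn before the
  first movement, which could fail now that the simulating agent has already moved. It takes no time
  but produces one observation, which keeps both agents aligned step by step.\<close>

definition wait :: action where "wait = Walk (\<lambda>_. 0) 0"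

text \<open>\<open>S\<close> is the time left, \<open>m\<close> says whether the simulated agent has
  moved, and \<open>E\<close> takes over at the end. The step bound \<open>n\<close> is a second
  stopping rule besides the deadline, since infinitely many steps may fit into bounded time.\<close>

primrec sim :: "nat \<Rightarrow> agent \<Rightarrow> real stream \<Rightarrow> real \<Rightarrow> bool \<Rightarrow> agent \<Rightarrow> agent" where
  "sim 0 A v S m E h = E h"
| "sim (Suc n) A v S m E h = (case h of
      [] \<Rightarrow> (case A [] of Turn \<Rightarrow> if m then Turn else wait | Walk g d \<Rightarrow> Walk g (min d S) | Query \<Rightarrow> wait)
    | z # h' \<Rightarrow> (case A [] of
        Turn \<Rightarrow> sim n (after A Silent) (stl v) S m E h'
      | Query \<Rightarrow> sim n (after A (Answer (shd v))) (stl v) S m E h'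
      | Walk g d \<Rightarrow> (case z of
          Walked r q \<Rightarrow> if S \<le> r then E h' else sim n (after A z) (stl v) (S - r) (m \<or> g r > 0) E h'
        | _ \<Rightarrow> E h')))"

text \<open>Turns before the first movement do not fail, so the direction of that movement is a
  function of the oracle answers alone and can be computed in advance. As \<open>g\<close> is
  monotone, \<open>g d = 0\<close> means standing still at the origin, which is observed as
  \<open>Walked d True\<close>.\<close>

primrec initial_dir :: "nat \<Rightarrow> agent \<Rightarrow> real stream \<Rightarrow> real \<Rightarrow> real" where
  "initial_dir 0 A v \<sigma> = \<sigma>"
| "initial_dir (Suc n) A v \<sigma> = (case A [] of
      Turn \<Rightarrow> initial_dir n (after A Silent) (stl v) (- \<sigma>)
    | Query \<Rightarrow> initial_dir n (after A (Answer (shd v))) (stl v) \<sigma>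
    | Walk g d \<Rightarrow> if g d > 0 then \<sigma> else initial_dir n (after A (Walked d True)) (stl v) \<sigma>)"

lemma initial_dir_cases:
  assumes "\<sigma> = 1 \<or> \<sigma> = -1"
  shows "initial_dir n A v \<sigma> = 1 \<or> initial_dir n A v \<sigma> = -1"
proof -
  have "\<bar>initial_dir n A v \<sigma>\<bar> = \<bar>\<sigma>\<bar>"
    by (induction n arbitrary: A v \<sigma>) (auto split: action.splits)
  then show ?thesis using assms by auto
qed

text \<open>Here \<open>t\<close> is the reaching time of the simulated agent and \<open>W\<close> a
  bound on the expected time after a simulation that missed the target before the deadline
  \<open>S\<close>.\<close>

definition cost :: "real \<Rightarrow> real \<Rightarrow> ennreal \<Rightarrow> real" where
  "cost S W t = (if t < ennreal S then enn2real t else S + W)"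

lemma cost_measurable [measurable]: "cost S W \<in> borel_measurable borel"
  unfolding cost_def by measurable

lemma cost_bounds:
  assumes "0 \<le> S" "0 \<le> W"
  shows "0 \<le> cost S W t" "cost S W t \<le> S + W"
proof -
  have "enn2real t \<le> S" if "t < ennreal S"
    using that assms by (intro enn2real_leI) auto
  then show "0 \<le> cost S W t" "cost S W t \<le> S + W"
    using assms unfolding cost_def by force+
qed

lemma cost_shift:
  assumes "0 \<le> r" "r < S"
  shows "cost S W (ennreal r + t) = r + cost (S - r) W t"
proof (cases t)
  case (real u)
  then show ?thesis using assms
    by (auto simp: cost_def ennreal_less_iff simp flip: ennreal_plus)
next
  case top
  then show ?thesis by (simp add: cost_def)
qed

section \<open>Shortened and mirrored walks\<close>

lemma walk_duration_min:
  assumes adm: "admissible (Walk g d)" and "0 \<le> S"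
  shows "walk_duration y \<sigma> g (min d S) = min (walk_duration y \<sigma> g d) S"
proof (cases "y \<noteq> 0 \<and> (\<exists>r\<in>{0..d}. y + \<sigma> * g r = 0)")
  case True
  define z where "z = Inf {r \<in> {0..d}. y + \<sigma> * g r = 0}"
  have z: "z \<in> {0..d}" "y + \<sigma> * g z = 0" "\<And>r. r \<in> {0..d} \<Longrightarrow> y + \<sigma> * g r = 0 \<Longrightarrow> z \<le> r"
    using walk_zero_Inf[OF adm, of y \<sigma>] True unfolding z_def by auto
  have wd: "walk_duration y \<sigma> g d = z"
    using True unfolding walk_duration_def z_def by auto
  show ?thesis
  proof (cases "z \<le> S")
    case zS: True
    then have ex: "\<exists>r\<in>{0..min d S}. y + \<sigma> * g r = 0" using z by auto
    have "Inf {r \<in> {0..min d S}. y + \<sigma> * g r = 0} = z"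
      by (rule cInf_eq_minimum) (use z zS in auto)
    then show ?thesis using wd zS True ex by (simp add: walk_duration_def)
  next
    case False
    then have "\<not> (\<exists>r\<in>{0..min d S}. y + \<sigma> * g r = 0)" using z(3) by force
    then show ?thesis using wd False z(1) by (auto simp: walk_duration_def)
  qed
next
  case False
  then have "\<not> (y \<noteq> 0 \<and> (\<exists>r\<in>{0..min d S}. y + \<sigma> * g r = 0))" by auto
  then show ?thesis using False unfolding walk_duration_def by (simp only: if_False)
qed

lemma admissible_min: "admissible (Walk g d) \<Longrightarrow> 0 \<le> S \<Longrightarrow> admissible (Walk g (min d S))"
  by (auto simp: admissible_def)

lemma mirror_zero:
  fixes \<tau> :: real
  assumes "\<tau> = 1 \<or> \<tau> = -1"
  shows "\<tau> * y + \<tau> * \<sigma> * u = 0 \<longleftrightarrow> y + \<sigma> * u = 0"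
  using assms by auto

lemma walk_duration_mirror:
  assumes "\<tau> = 1 \<or> \<tau> = -1"
  shows "walk_duration (\<tau> * y) (\<tau> * \<sigma>) g d = walk_duration y \<sigma> g d"
  unfolding walk_duration_def mirror_zero[OF assms] using assms by auto

lemma hit_mirror:
  assumes "\<tau> = 1 \<or> \<tau> = -1"
  shows "hit x (Walk g d) (\<tau> * y, \<tau> * \<sigma>, m) = hit (\<tau> * x) (Walk g d) (y, \<sigma>, m')"
proof -
  have "x = \<tau> * y + \<tau> * \<sigma> * g r \<longleftrightarrow> \<tau> * x = y + \<sigma> * g r" for r
    using assms by (auto simp: algebra_simps)
  then show ?thesis by (simp add: walk_duration_mirror[OF assms])
qed

lemma hit_cases:
  obtains "hit x (Walk g d) (y, \<sigma>, m) = \<infinity>"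
  | t where "hit x (Walk g d) (y, \<sigma>, m) = ennreal t" "0 \<le> t" "t \<le> walk_duration y \<sigma> g d"
proof (cases "{r. 0 \<le> r \<and> r \<le> walk_duration y \<sigma> g d \<and> x = y + \<sigma> * g r} = {}")
  case True
  then have "hit x (Walk g d) (y, \<sigma>, m) = \<infinity>" by (simp only: hit.simps) simp
  then show ?thesis using that by blast
next
  case False
  then obtain r where r: "0 \<le> r" "r \<le> walk_duration y \<sigma> g d" "x = y + \<sigma> * g r" by auto
  then have "hit x (Walk g d) (y, \<sigma>, m) \<le> ennreal r"
    by (auto intro: INF_lower)
  also have "\<dots> \<le> ennreal (walk_duration y \<sigma> g d)" using r by (auto intro: ennreal_leI)
  finally have le: "hit x (Walk g d) (y, \<sigma>, m) \<le> ennreal (walk_duration y \<sigma> g d)" .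
  then have "hit x (Walk g d) (y, \<sigma>, m) \<noteq> top"
    by (metis ennreal_less_top le_less_trans less_irrefl)
  then obtain t where t: "hit x (Walk g d) (y, \<sigma>, m) = ennreal t" "0 \<le> t"
    by (cases "hit x (Walk g d) (y, \<sigma>, m)") blast+
  moreover have "t \<le> walk_duration y \<sigma> g d"
    using le r unfolding t(1) by (subst (asm) ennreal_le_iff) auto
  ultimately show ?thesis using that(2) by blast
qed

lemma hit_min_le:
  assumes adm: "admissible (Walk g d)" and "0 \<le> S" and less: "hit x (Walk g d) (y, \<sigma>, m) < ennreal S"
  shows "hit x (Walk g (min d S)) (y, \<sigma>, m) \<le> hit x (Walk g d) (y, \<sigma>, m)"
proof -
  let ?R = "\<lambda>d. {r. 0 \<le> r \<and> r \<le> walk_duration y \<sigma> g d \<and> x = y + \<sigma> * g r}"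
  have low: "hit x (Walk g (min d S)) (y, \<sigma>, m) \<le> ennreal r" if "r \<in> ?R d" "r < S" for r
    using that by (auto simp: walk_duration_min[OF assms(1,2)] intro!: INF_lower)
  obtain r0 where r0: "r0 \<in> ?R d" "ennreal r0 < ennreal S"
    using less unfolding hit.simps INF_less_iff by blast
  have "hit x (Walk g (min d S)) (y, \<sigma>, m) \<le> ennreal r" if "r \<in> ?R d" for r
  proof (cases "r < S")
    case False
    moreover have "r0 < S" using r0 assms(2) by (auto simp: ennreal_less_iff)
    ultimately have "ennreal r0 \<le> ennreal r" by (intro ennreal_leI) simp
    then show ?thesis using low[OF r0(1) \<open>r0 < S\<close>] by (meson order_trans)
  qed (use low that in blast)
  then show ?thesis unfolding hit.simps by (intro INF_greatest)
qed

lemma val_wait: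
  assumes "0 \<le> M" "B [] = wait"
  shows "val x M B (y, \<sigma>, True) \<le> val x M (after B (Walked 0 (y = 0))) (y, \<sigma>, True)"
proof -
  have "walk_duration y \<sigma> (\<lambda>_. 0) 0 = 0" by (auto simp: walk_duration_def)
  moreover have "admissible (Walk (\<lambda>_. 0) 0)" by (auto simp: admissible_def)
  ultimately show ?thesis
    using val_Walk[where B = B and g = "\<lambda>_. 0" and d = 0 and r = 0 and x = x and y = y and \<sigma> = \<sigma> and m = True,
      OF assms(1) assms(2)[unfolded wait_def]] by simp
qed

lemma sim_measurable: "Fmeas (\<lambda>b. cost S W (rt x n A v s b))"
  by measurable

text \<open>
  The simulation may be mirrored (\<open>\<tau> = -1\<close>), and it starts in the direction that the simulated
  agent will have chosen when it moves for the first time, so that the turns before that are skipped.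
\<close>

lemma val_sim:
  assumes M: "0 \<le> M" and x: "x \<noteq> 0" and \<tau>: "\<tau> = 1 \<or> \<tau> = -1"
    and E: "\<And>y \<sigma>. \<sigma> = 1 \<or> \<sigma> = -1 \<Longrightarrow> \<bar>y\<bar> \<le> D \<Longrightarrow> val x M E (y, \<sigma>, True) \<le> W"
    and "\<And>h. admissible (A h)" and "\<sigma> = 1 \<or> \<sigma> = -1" and "0 < S" and "\<bar>y\<bar> + S \<le> D"
    and "\<not> m \<Longrightarrow> y = 0"
  shows "val x M (sim n A v S m E) (\<tau> * y, \<tau> * (if m then \<sigma> else initial_dir n A v \<sigma>), True)
    \<le> EB (\<lambda>b. cost S W (rt (\<tau> * x) n A v (y, \<sigma>, m) b))"
  using assms(5-9)
proof (induction n arbitrary: A v S m y \<sigma>)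
  case 0
  have "\<bar>\<tau> * y\<bar> \<le> D" "\<tau> * \<sigma> = 1 \<or> \<tau> * \<sigma> = -1" using 0 \<tau> by auto
  then have "val x M E (\<tau> * y, \<tau> * \<sigma>, True) \<le> S + W"
    using E[of "\<tau> * \<sigma>" "\<tau> * y"] 0 by simp
  moreover have "sim 0 A v S m E = E" by (simp add: fun_eq_iff)
  ultimately show ?case by (simp add: cost_def)
next
  case (Suc n)
  define \<sigma>' where "\<sigma>' = (if m then \<sigma> else initial_dir (Suc n) A v \<sigma>)"
  have \<sigma>': "\<sigma>' = 1 \<or> \<sigma>' = -1"
    using initial_dir_cases[OF Suc.prems(2), of "Suc n" A v] Suc.prems(2)
    unfolding \<sigma>'_def by (simp del: initial_dir.simps)
  have "\<bar>y\<bar> \<le> D" using Suc.prems by simp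
  then have W: "0 \<le> W" using E[of 1 y] val_nonneg[OF M, of x E "(y, 1, True)"] by simp
  have adm': "admissible (after A z h)" for z h
    unfolding after_def by (rule Suc.prems(1))
  let ?B = "sim (Suc n) A v S m E"
  let ?f = "\<lambda>b. cost S W (rt (\<tau> * x) (Suc n) A v (y, \<sigma>, m) b)"
  have f0: "0 \<le> ?f b" "?f b \<le> S + W" for b
    using cost_bounds[OF _ W] Suc.prems(3) by auto
  have fm: "Fmeas ?f" by (rule sim_measurable)
  have "val x M ?B (\<tau> * y, \<tau> * \<sigma>', True) \<le> EB ?f"
  proof (cases "A []")
    case Query
    let ?A = "after A (Answer (shd v))"
    have "val x M ?B (\<tau> * y, \<tau> * \<sigma>', True) \<le> val x M (after ?B (Walked 0 (\<tau> * y = 0))) (\<tau> * y, \<tau> * \<sigma>', True)"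
      by (rule val_wait[OF M]) (simp add: Query)
    also have "after ?B (Walked 0 (\<tau> * y = 0)) = sim n ?A (stl v) S m E"
      by (simp add: after_def fun_eq_iff Query)
    also have "val x M \<dots> (\<tau> * y, \<tau> * \<sigma>', True) \<le> EB (\<lambda>b. cost S W (rt (\<tau> * x) n ?A (stl v) (y, \<sigma>, m) b))"
      using Suc.IH[of ?A \<sigma> S y m "stl v", OF adm' Suc.prems(2-5)] Query
      unfolding \<sigma>'_def by (cases m) simp_all
    also have "\<dots> = EB ?f"
      using EB_shift_eq[where f = ?f and d = 0 and M = "S + W", OF fm sim_measurable f0(1)]
        cost_bounds[OF _ W] Suc.prems(3) by (simp add: Query)
    finally show ?thesis .
  next
    case Turn
    let ?A = "after A Silent"
    show ?thesis
    proof (cases m)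
      case True
      have aft: "after ?B Silent = sim n ?A (stl v) S m E"
        by (simp add: after_def fun_eq_iff Turn)
      have IH: "val x M (after ?B Silent) (\<tau> * y, \<tau> * \<rho>, True) \<le>
        EB (\<lambda>b. cost S W (rt (\<tau> * x) n ?A (stl v) (y, \<rho>, m) b))" if "\<rho> = 1 \<or> \<rho> = -1" for \<rho>
        using Suc.IH[of ?A \<rho> S y m "stl v", OF adm' that Suc.prems(3-5)] True unfolding aft by simp
      have "?B [] = Turn" using True Turn by simp
      from val_Turn[where B = ?B, OF M this]
      have "val x M ?B (\<tau> * y, \<tau> * \<sigma>', True) =
        p * val x M (after ?B Silent) (\<tau> * y, \<tau> * \<sigma>, True) +
        (1 - p) * val x M (after ?B Silent) (\<tau> * y, \<tau> * (- \<sigma>), True)"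
        using True by (simp add: \<sigma>'_def)
      also have "\<dots> \<le> p * EB (\<lambda>b. cost S W (rt (\<tau> * x) n ?A (stl v) (y, \<sigma>, m) b)) +
        (1 - p) * EB (\<lambda>b. cost S W (rt (\<tau> * x) n ?A (stl v) (y, - \<sigma>, m) b))"
        by (intro add_mono mult_left_mono IH) (use Suc.prems(2) p_pos p_less_half in auto)
      also have "\<dots> = EB ?f"
        unfolding EB_unfold[OF fm f0] by (simp add: Turn True)
      finally show ?thesis .
    next
      case False
      have "val x M ?B (\<tau> * y, \<tau> * \<sigma>', True) \<le> val x M (after ?B (Walked 0 (\<tau> * y = 0))) (\<tau> * y, \<tau> * \<sigma>', True)"
        by (rule val_wait[OF M]) (simp add: Turn False)
      also have "after ?B (Walked 0 (\<tau> * y = 0)) = sim n ?A (stl v) S m E"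
        by (simp add: after_def fun_eq_iff Turn)
      also have "val x M \<dots> (\<tau> * y, \<tau> * \<sigma>', True) \<le> EB (\<lambda>b. cost S W (rt (\<tau> * x) n ?A (stl v) (y, - \<sigma>, m) b))"
        using Suc.IH[of ?A "- \<sigma>" S y m "stl v", OF adm' _ Suc.prems(3-5)] Suc.prems(2) Turn False
        unfolding \<sigma>'_def by auto
      also have "\<dots> = EB ?f"
        using EB_shift_eq[where f = ?f and d = 0 and M = "S + W", OF fm sim_measurable f0(1)]
          cost_bounds[OF _ W] Suc.prems(3) False by (simp add: Turn)
      finally show ?thesis .
    qed
  next
    case (Walk g d)
    have adm: "admissible (Walk g d)" using Suc.prems(1) Walk by metis
    define r where "r = walk_duration y \<sigma> g d"
    have r: "0 \<le> r" "r \<le> d" using walk_duration_bounds[OF adm] unfolding r_def by auto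
    have gr: "0 \<le> g r" "g r \<le> r" "g r \<le> g d"
      using admissible_WalkD(2)[OF adm] admissible_WalkD(3,4)[OF adm, of 0 r] admissible_WalkD(3)[OF adm, of r d] r
      by auto
    \<comment> \<open>Only in the last case may the simulating and the simulated agent face
      directions that do not correspond. It does not matter there, because the walk stays at the
      origin.\<close>
    have still: "m \<or> 0 < g d \<or> (y = 0 \<and> r = d \<and> (\<forall>t\<in>{0..d}. g t = 0))"
    proof (cases "m \<or> 0 < g d")
      case False
      then have "g t = 0" if "t \<in> {0..d}" for t
        using admissible_WalkD(2)[OF adm] admissible_WalkD(3)[OF adm, of 0 t] admissible_WalkD(3)[OF adm, of t d] that
        by auto
      then show ?thesis using False Suc.prems(5) by (auto simp: r_def walk_duration_def)
    qed auto
    have \<sigma>'_eq: "\<sigma>' = \<sigma>" if "m \<or> 0 < g d" using that Walk by (auto simp: \<sigma>'_def)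
    have rB: "walk_duration (\<tau> * y) (\<tau> * \<sigma>') g (min d S) = min r S"
    proof (cases "m \<or> 0 < g d")
      case True
      then show ?thesis using \<sigma>'_eq walk_duration_min[OF adm] walk_duration_mirror[OF \<tau>] Suc.prems(3) r_def by simp
    next
      case False
      then show ?thesis using still by (auto simp: walk_duration_def)
    qed
    have posB: "\<tau> * y + \<tau> * \<sigma>' * g t = \<tau> * (y + \<sigma> * g t)" if "t \<in> {0..d}" for t
      using still \<sigma>'_eq that by (auto simp: algebra_simps)
    have BWalk: "?B [] = Walk g (min d S)" by (simp add: Walk)
    have admB: "admissible (Walk g (min d S))" using admissible_min[OF adm] Suc.prems(3) by simp
    have hitB: "hit x (Walk g (min d S)) (\<tau> * y, \<tau> * \<sigma>', True) \<le> hit (\<tau> * x) (Walk g d) (y, \<sigma>, m)"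
      if "hit (\<tau> * x) (Walk g d) (y, \<sigma>, m) < ennreal S"
    proof (cases "m \<or> 0 < g d")
      case True
      have "hit x (Walk g d) (\<tau> * y, \<tau> * \<sigma>', True) = hit (\<tau> * x) (Walk g d) (y, \<sigma>, m)"
        unfolding \<sigma>'_eq[OF True] by (rule hit_mirror[OF \<tau>])
      then show ?thesis using hit_min_le[OF adm, of S x "\<tau> * y" "\<tau> * \<sigma>'" True] that Suc.prems(3) by simp
    next
      case False
      then have "{t. 0 \<le> t \<and> t \<le> walk_duration y \<sigma> g d \<and> \<tau> * x = y + \<sigma> * g t} = {}"
        using still x \<tau> r_def by auto
      then have "hit (\<tau> * x) (Walk g d) (y, \<sigma>, m) = \<infinity>" by (simp only: hit.simps) simp
      then show ?thesis by (simp del: hit.simps)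
    qed
    have hit_val: "val x M ?B (\<tau> * y, \<tau> * \<sigma>', True) \<le> t"
      if "hit (\<tau> * x) (Walk g d) (y, \<sigma>, m) = ennreal t" "0 \<le> t" "t < S" for t
      by (rule val_hit[OF M]) (use hitB that BWalk in \<open>auto simp: ennreal_less_iff\<close>)
    have EBc: "c \<le> EB ?f" if "\<And>b. c \<le> ?f b" "0 \<le> c" for c
      using EB_mono[where f = "\<lambda>_. c" and g = ?f and M = "S + W", OF _ fm] that f0 by auto
    let ?z = "Walked r (y + \<sigma> * g r = 0)"
    let ?A = "after A ?z"
    have rtS: "rt (\<tau> * x) (Suc n) A v (y, \<sigma>, m) (c ## b) = min (hit (\<tau> * x) (Walk g d) (y, \<sigma>, m))
      (ennreal r + rt (\<tau> * x) n ?A (stl v) (y + \<sigma> * g r, \<sigma>, m \<or> 0 < g r) b)" for c b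
      by (simp add: Walk r_def)
    show ?thesis
    proof (cases "r < S")
      case True
      show ?thesis
      proof (rule hit_cases[of "\<tau> * x" g d y \<sigma> m])
        fix t assume t: "hit (\<tau> * x) (Walk g d) (y, \<sigma>, m) = ennreal t" "0 \<le> t" "t \<le> walk_duration y \<sigma> g d"
        then have tS: "t < S" "t \<le> r" using True r_def by auto
        have "rt (\<tau> * x) (Suc n) A v (y, \<sigma>, m) (c ## b) = ennreal t" for c b
          unfolding rtS t(1) using tS(2) by (intro min.absorb1) (auto intro: add_increasing2 ennreal_leI)
        then have "?f (c ## b) = t" for c b
          using tS t(2) by (simp add: cost_def ennreal_less_iff)
        then have "?f b = t" for b by (metis stream.collapse)
        then show ?thesis using hit_val[OF t(1,2) tS(1)] by simp
      next
        assume inf: "hit (\<tau> * x) (Walk g d) (y, \<sigma>, m) = \<infinity>"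
        let ?g = "\<lambda>b. cost (S - r) W (rt (\<tau> * x) n ?A (stl v) (y + \<sigma> * g r, \<sigma>, m \<or> 0 < g r) b)"
        have rm: "r \<in> {0..d}" "min r S = r" using r True by auto
        have zB: "(\<tau> * y + \<tau> * \<sigma>' * g r = 0) = (y + \<sigma> * g r = 0)" using posB[OF rm(1)] \<tau> by auto
        have aft: "after ?B ?z = sim n ?A (stl v) (S - r) (m \<or> 0 < g r) E"
          using True by (simp add: after_def fun_eq_iff Walk)
        have "val x M ?B (\<tau> * y, \<tau> * \<sigma>', True) \<le> r + val x M (after ?B ?z) (\<tau> * (y + \<sigma> * g r), \<tau> * \<sigma>', True)"
          using val_Walk[where B = ?B and r = r and x = x and y = "\<tau> * y" and \<sigma> = "\<tau> * \<sigma>'" and m = True,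
              OF M BWalk admB] rB rm zB posB[OF rm(1)] by simp
        also have "val x M (after ?B ?z) (\<tau> * (y + \<sigma> * g r), \<tau> * \<sigma>', True) \<le> EB ?g"
        proof -
          have d: "\<sigma>' = (if m \<or> 0 < g r then \<sigma> else initial_dir n ?A (stl v) \<sigma>)"
          proof (cases "m \<or> 0 < g d")
            case True
            then have "m \<or> 0 < g r" using Suc.prems(5) by (auto simp: r_def walk_duration_def)
            then show ?thesis using \<sigma>'_eq[OF True] by simp
          next
            case False
            then have "y = 0" "r = d" "\<not> 0 < g r" "\<not> m" "g d = 0" using still r by auto
            then show ?thesis using Walk False by (simp add: \<sigma>'_def)
          qed
          have "\<bar>y + \<sigma> * g r\<bar> + (S - r) \<le> D" using Suc.prems(2,4) gr by auto
          moreover have "y + \<sigma> * g r = 0" if "\<not> (m \<or> 0 < g r)" using that gr Suc.prems(5) by auto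
          ultimately show ?thesis
            unfolding aft using Suc.IH[of ?A \<sigma> "S - r" "y + \<sigma> * g r" "m \<or> 0 < g r" "stl v", OF adm' Suc.prems(2)] d True
            by simp
        qed
        also have "r + EB ?g = EB ?f"
        proof (rule EB_shift_eq[symmetric, where M = "S - r + W", OF fm sim_measurable f0(1)])
          show "0 \<le> ?g b" "?g b \<le> S - r + W" for b using cost_bounds[of "S - r" W] True W by auto
          show "?f (c ## b) = r + ?g b" for c b
            unfolding rtS inf using cost_shift[OF r(1) True] by simp
        qed
        finally show ?thesis by simp
      qed
    next
      case False
      then have rm: "min r S = S" "S \<in> {0..d}" using Suc.prems(3) r by auto
      \<comment> \<open>The deadline falls into this walk. Either the shortened walk meets the
        target before time \<open>S\<close>, or \<open>E\<close> takes over after exactly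
        \<open>S\<close>; later faults are irrelevant to the cost, so the bound is pointwise in
        \<open>b\<close>.\<close>
      have "val x M ?B (\<tau> * y, \<tau> * \<sigma>', True) \<le> S + W"
      proof -
        let ?y = "\<tau> * y + \<tau> * \<sigma>' * g S"
        have aft: "after ?B (Walked S (?y = 0)) = E"
          by (simp add: after_def fun_eq_iff Walk)
        have "val x M ?B (\<tau> * y, \<tau> * \<sigma>', True) \<le> S + val x M E (?y, \<tau> * \<sigma>', True)"
          using val_Walk[where B = ?B and r = S and x = x and y = "\<tau> * y" and \<sigma> = "\<tau> * \<sigma>'" and m = True,
              OF M BWalk admB] rB rm aft by simp
        moreover have "g S \<le> S" "0 \<le> g S"
          using admissible_WalkD(2)[OF adm] admissible_WalkD(3,4)[OF adm, of 0 S] rm by auto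
        then have "\<bar>?y\<bar> \<le> D" "\<tau> * \<sigma>' = 1 \<or> \<tau> * \<sigma>' = -1" using \<tau> \<sigma>' Suc.prems(4) by auto
        ultimately show ?thesis using E by force
      qed
      moreover have "val x M ?B (\<tau> * y, \<tau> * \<sigma>', True) \<le> ?f (c ## b)" if nS: "\<not> ?f (c ## b) = S + W" for c b
      proof -
        have lt: "rt (\<tau> * x) (Suc n) A v (y, \<sigma>, m) (c ## b) < ennreal S"
          using nS unfolding cost_def by (auto split: if_splits)
        have "ennreal S \<le> ennreal r + u" for u
          using ennreal_leI[of S r] False by (intro add_increasing2) auto
        then have "rt (\<tau> * x) (Suc n) A v (y, \<sigma>, m) (c ## b) = hit (\<tau> * x) (Walk g d) (y, \<sigma>, m)"
          using lt unfolding rtS by (metis min_def leD)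
        moreover obtain t where "hit (\<tau> * x) (Walk g d) (y, \<sigma>, m) = ennreal t" "0 \<le> t"
          using lt calculation
          by (cases "hit (\<tau> * x) (Walk g d) (y, \<sigma>, m)") (auto simp del: hit.simps rt.simps)
        ultimately show ?thesis
          using hit_val[of t] lt by (simp add: cost_def ennreal_less_iff del: hit.simps rt.simps)
      qed
      ultimately have "val x M ?B (\<tau> * y, \<tau> * \<sigma>', True) \<le> ?f b" for b
        by (metis stream.collapse)
      then show ?thesis using EBc val_nonneg[OF M] by blast
    qed
  qed
  then show ?case unfolding \<sigma>'_def .
qed

end

section \<open>Phases\<close>

context faulty
begin

definition late :: "real \<Rightarrow> ennreal \<Rightarrow> real" where
  "late S t = (if t < ennreal S then 0 else 1)"

lemma late_measurable [measurable]: "late S \<in> borel_measurable borel"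
  unfolding late_def by measurable

lemma late_bounds: "0 \<le> late S t" "late S t \<le> 1"
  by (auto simp: late_def)

lemma cost_split: "0 \<le> S \<Longrightarrow> cost S W t = trunc S t + W * late S t"
  by (auto simp: cost_def trunc_def late_def min_def not_less)

text \<open>Markov's inequality before integration. It later converts the cost of a return after a
  miss into simulated time.\<close>

lemma late_le_trunc: "0 \<le> S \<Longrightarrow> S * late S t \<le> trunc S t"
  by (auto simp: trunc_def late_def min_def not_less)

lemma EB_cost:
  assumes "0 \<le> S" and [measurable]: "f \<in> borel_measurable faults"
  shows "EB (\<lambda>b. cost S W (f b)) = EB (\<lambda>b. trunc S (f b)) + W * EB (\<lambda>b. late S (f b))"
proof -
  have "integrable faults (\<lambda>b. trunc S (f b))" "integrable faults (\<lambda>b. late S (f b))"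
    by (rule integrable_faults[where M = S], auto simp: trunc_bounds assms(1))
      (rule integrable_faults[where M = 1], auto simp: late_bounds)
  then show ?thesis
    unfolding EB_def cost_split[OF assms(1)] by simp
qed

text \<open>A turn at the origin could fail unnoticed. If the simulated agent starts in direction
  -1, the direction is therefore reversed by an excursion whose bit is ignored.\<close>

definition phase :: "nat \<Rightarrow> real \<Rightarrow> nat \<Rightarrow> real \<Rightarrow> agent \<Rightarrow> (bool list \<Rightarrow> real stream) \<Rightarrow> agent \<Rightarrow> agent" where
  "phase N D n S A v K = bits N D (\<lambda>bs.
    if initial_dir n A (v bs) 1 = 1 then sim n A (v bs) S False (homing_blind S K)
    else excursion D (\<lambda>_. sim n A (v bs) S False (homing_blind S K)))"

abbreviation start :: phys where "start \<equiv> (0, 1, False)"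

text \<open>The direction after the \<open>N\<close> excursions is
  \<open>\<tau> = (-1) ^ N * \<sigma>\<close>. Since \<open>\<sigma>\<close> is unknown to the
  agent, it may be simulating the mirror image, for which the target lies at
  \<open>\<tau> * x\<close>. A miss is followed by a blind return at scale \<open>S\<close> and then
  by \<open>K\<close>, which explains the factor of the last sum; \<open>N + 1\<close> includes the
  excursion that may reverse the direction.\<close>

lemma val_phase:
  assumes M: "0 \<le> M" and x: "x \<noteq> 0" and A: "\<And>h. admissible (A h)" and D: "0 < D" and S: "0 < S"
    and \<sigma>: "\<sigma> = 1 \<or> \<sigma> = -1"
    and W: "\<And>\<rho>. \<rho> = 1 \<or> \<rho> = -1 \<Longrightarrow> val x M K (0, \<rho>, True) \<le> W"
  shows "\<exists>\<tau>. (\<tau> = 1 \<or> \<tau> = -1) \<and> val x M (phase N D n S A v K) (0, \<sigma>, True) \<le> (N + 1) * (1 + C) * D +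
    (\<Sum>bs\<in>words N. wt bs * EB (\<lambda>b. trunc S (rt (\<tau> * x) n A (v bs) start b))) +
    ((1 + 2 * C) * S + W) * (\<Sum>bs\<in>words N. wt bs * EB (\<lambda>b. late S (rt (\<tau> * x) n A (v bs) start b)))"
proof -
  define \<tau> where "\<tau> = (-1) ^ N * \<sigma>"
  have \<tau>: "\<tau> = 1 \<or> \<tau> = -1" using \<sigma> unfolding \<tau>_def by (cases "even N") auto
  define E where "E = homing_blind S K"
  define K' where "K' = (\<lambda>bs. if initial_dir n A (v bs) 1 = 1 then sim n A (v bs) S False E
    else excursion D (\<lambda>_. sim n A (v bs) S False E))"
  define X where "X = (\<lambda>bs. EB (\<lambda>b. cost S ((1 + 2 * C) * S + W) (rt (\<tau> * x) n A (v bs) start b)))"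
  have E: "val x M E (y, \<rho>, True) \<le> (1 + 2 * C) * S + W" if "\<rho> = 1 \<or> \<rho> = -1" "\<bar>y\<bar> \<le> S" for y \<rho>
    unfolding E_def using W[of \<rho>] W[of "- \<rho>"] that S by (intro val_homing_blind M) auto
  have sim: "val x M (sim n A (v bs) S False E) (0, \<tau> * initial_dir n A (v bs) 1, True) \<le> X bs" for bs
    using val_sim[where M = M and x = x and \<tau> = \<tau> and E = E and D = S and W = "(1 + 2 * C) * S + W"
        and A = A and \<sigma> = 1 and S = S and y = 0 and m = False and n = n and v = "v bs", OF M x \<tau> E A] S
    unfolding X_def by simp
  have K': "val x M (K' bs) (0, \<tau>, True) \<le> (1 + C) * D + X bs" for bs
  proof (cases "initial_dir n A (v bs) 1 = 1")
    case True
    have "0 \<le> (1 + C) * D" using C_props(1) D by simp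
    then show ?thesis using sim[of bs] True unfolding K'_def by simp
  next
    case False
    then have d: "initial_dir n A (v bs) 1 = -1" using initial_dir_cases[of 1 n A "v bs"] by auto
    have "val x M (K' bs) (0, \<tau>, True) \<le> (1 + C) * D + p * X bs + (1 - p) * X bs"
      unfolding K'_def using False sim[of bs] d p_pos p_less_half
      by (auto intro!: order_trans[OF val_excursion[OF M \<tau> D]] add_mono mult_left_mono)
    then show ?thesis by (simp add: algebra_simps)
  qed
  have "val x M (phase N D n S A v K) (0, \<sigma>, True) \<le> N * (1 + C) * D +
    (\<Sum>bs\<in>words N. wt bs * val x M (K' bs) (0, \<tau>, True))"
    using val_bits[OF M D \<sigma>, of x N K'] unfolding phase_def K'_def E_def \<tau>_def by simp
  also have "\<dots> \<le> N * (1 + C) * D + (\<Sum>bs\<in>words N. wt bs * ((1 + C) * D + X bs))"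
    by (intro add_left_mono sum_mono mult_left_mono K') (simp add: wt_pos less_imp_le)
  also have "\<dots> = (N + 1) * (1 + C) * D + (\<Sum>bs\<in>words N. wt bs * X bs)"
    by (simp add: distrib_left sum.distrib sum_wt flip: sum_distrib_right) (simp add: algebra_simps)
  also have "(\<Sum>bs\<in>words N. wt bs * X bs) =
    (\<Sum>bs\<in>words N. wt bs * EB (\<lambda>b. trunc S (rt (\<tau> * x) n A (v bs) start b))) +
    ((1 + 2 * C) * S + W) * (\<Sum>bs\<in>words N. wt bs * EB (\<lambda>b. late S (rt (\<tau> * x) n A (v bs) start b)))"
  proof -
    have "wt bs * X bs = wt bs * EB (\<lambda>b. trunc S (rt (\<tau> * x) n A (v bs) start b)) +
      ((1 + 2 * C) * S + W) * (wt bs * EB (\<lambda>b. late S (rt (\<tau> * x) n A (v bs) start b)))" for bs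
      using S unfolding X_def by (subst EB_cost) (auto simp: algebra_simps)
    then show ?thesis by (simp add: sum.distrib flip: sum_distrib_left)
  qed
  finally show ?thesis using \<tau> by (intro exI[of _ \<tau>]) (simp add: algebra_simps)
qed

section \<open>Infinite sequences of phases\<close>

definition ok :: "action \<Rightarrow> bool" where
  "ok a \<longleftrightarrow> admissible a \<and> a \<noteq> Query"

lemma ok_intros: "ok Turn" "ok wait" "0 \<le> D \<Longrightarrow> ok (Walk (\<lambda>t. t) D)"
  by (auto simp: ok_def wait_def admissible_def)

text \<open>
  Instantiating \<open>Q\<close> with equality and with \<open>\<lambda>a _. ok a\<close>, the following says that an action depends
  only on the continuations at shorter histories, and that it is fine if these are.
\<close>

context
  fixes Q :: "action \<Rightarrow> action \<Rightarrow> bool"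
  assumes Q: "\<And>a. ok a \<Longrightarrow> Q a a"
begin

lemma homing_rel:
  assumes "0 \<le> D" "\<And>h'. length h' < length h \<Longrightarrow> Q (K h') (K' h')"
  shows "Q (homing D K h) (homing D K' h)"
  using assms by (induction D K h rule: homing.induct) (auto intro: Q ok_intros)

lemma homing_blind_rel:
  assumes "0 \<le> D" "\<And>h'. length h' < length h \<Longrightarrow> Q (K h') (K' h')"
  shows "Q (homing_blind D K h) (homing_blind D K' h)"
  using assms by (cases h) (auto intro!: Q ok_intros homing_rel)

lemma excursion_rel:
  assumes "0 \<le> D" "\<And>c h'. length h' < length h \<Longrightarrow> Q (K c h') (K' c h')"
  shows "Q (excursion D K h) (excursion D K' h)"
  using assms by (cases "(D, K, h)" rule: excursion.cases) (auto intro!: Q ok_intros homing_rel)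

lemma bits_rel:
  assumes "0 \<le> D" "\<And>bs h'. length h' \<le> length h \<Longrightarrow> Q (K bs h') (K' bs h')"
  shows "Q (bits N D K h) (bits N D K' h)"
  using assms(2)
proof (induction N arbitrary: K K' h)
  case (Suc N)
  then show ?case
    unfolding bits.simps by (intro excursion_rel assms(1) Suc.IH) auto
qed simp

lemma sim_rel:
  assumes "\<And>h. admissible (A h)" "0 \<le> S" "\<And>h'. length h' \<le> length h \<Longrightarrow> Q (E h') (E' h')"
  shows "Q (sim n A v S m E h) (sim n A v S m E' h)"
  using assms
proof (induction n arbitrary: A v S m h)
  case (Suc n)
  have A': "admissible (after A z h)" for z h unfolding after_def by (rule Suc.prems)
  have hd: "admissible (A [])" by (rule Suc.prems)
  show ?case
  proof (cases h)
    case Nil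
    then show ?thesis
      using Suc.prems(2) hd
      by (auto split: action.splits intro!: Q ok_intros) (auto simp: ok_def admissible_min)
  next
    case (Cons z h')
    then show ?thesis
      using Suc.prems by (auto split: action.splits observation.splits intro!: Suc.IH A')
  qed
qed simp

text \<open>The strict inequality is due to \<open>homing_blind\<close>, which makes at least one
  walk before it hands over to \<open>K\<close>; \<open>bits\<close> and \<open>sim\<close> alone
  may consume no observation. It makes the recursion through infinitely many phases
  well-founded.\<close>

lemma phase_rel:
  assumes "\<And>h. admissible (A h)" "0 \<le> S" "0 \<le> D" "\<And>h'. length h' < length h \<Longrightarrow> Q (K h') (K' h')"
  shows "Q (phase N D n S A v K h) (phase N D n S A v K' h)"
  unfolding phase_def
proof (rule bits_rel)
  fix bs and h' :: "observation list" assume h': "length h' \<le> length h"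
  have s: "Q (sim n A (v bs) S False (homing_blind S K) h'') (sim n A (v bs) S False (homing_blind S K') h'')"
    if "length h'' \<le> length h" for h''
    using that assms by (intro sim_rel homing_blind_rel) auto
  show "Q ((if initial_dir n A (v bs) 1 = 1 then sim n A (v bs) S False (homing_blind S K)
      else excursion D (\<lambda>_. sim n A (v bs) S False (homing_blind S K))) h')
     ((if initial_dir n A (v bs) 1 = 1 then sim n A (v bs) S False (homing_blind S K')
      else excursion D (\<lambda>_. sim n A (v bs) S False (homing_blind S K'))) h')"
    using h' s assms(3) by (auto intro!: excursion_rel)
qed (use assms in auto)

end

text \<open>Each \<open>P m\<close> consumes an observation before it consults its continuation, so
  the action at \<open>h\<close> is determined by the first \<open>length h + 1\<close> levels of
  the infinite nesting.\<close>

lemma exists_chain: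
  fixes P :: "nat \<Rightarrow> agent \<Rightarrow> agent"
  assumes cong: "\<And>m K K' h. (\<And>h'. length h' < length h \<Longrightarrow> K h' = K' h') \<Longrightarrow> P m K h = P m K' h"
  shows "\<exists>B. \<forall>m. B m = P m (B (Suc m))"
proof -
  \<comment> \<open>\<open>I k m\<close> unfolds \<open>k\<close> levels from \<open>m\<close> on
    and ends in a default agent. Histories shorter than \<open>k\<close> never get to that
    default.\<close>
  define I where "I = rec_nat (\<lambda>m h. Turn) (\<lambda>k F m. P m (F (Suc m)))"
  have I: "I (Suc k) m = P m (I k (Suc m))" for k m unfolding I_def by simp
  have eq: "I k m h = I k' m h" if "length h < k" "length h < k'" for k k' m h
    using that
  proof (induction k arbitrary: k' m h)
    case (Suc k)
    then obtain l where l: "k' = Suc l" by (cases k') auto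
    show ?case unfolding l I
      by (rule cong, rule Suc.IH) (use Suc.prems l in auto)
  qed simp
  define B where "B = (\<lambda>m h. I (Suc (length h)) m h)"
  have "B m h = P m (B (Suc m)) h" for m h
  proof -
    have "B m h = P m (I (length h) (Suc m)) h" unfolding B_def I ..
    also have "\<dots> = P m (B (Suc m)) h" by (rule cong) (auto simp: B_def intro: eq)
    finally show ?thesis .
  qed
  then show ?thesis by (intro exI[of _ B]) (auto simp: fun_eq_iff)
qed

lemma chain_ok:
  assumes B: "\<And>m. B m = P m (B (Suc m))"
    and P: "\<And>m K h. (\<And>h'. length h' < length h \<Longrightarrow> ok (K h')) \<Longrightarrow> ok (P m K h)"
  shows "ok (B m h)"
proof (induction "length h" arbitrary: m h rule: less_induct)
  case less
  show ?case unfolding B[of m] by (rule P) (rule less)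
qed

section \<open>Expected times of deterministic agents\<close>

abbreviation samples :: "real stream measure" where
  "samples \<equiv> stream_space (uniform_measure lborel {0..1})"

lemma chance_eq: "chance p = faults \<Otimes>\<^sub>M samples"
  unfolding chance_def faults_def ..

lemma prob_space_samples: "prob_space samples"
  by (intro prob_space.prob_space_stream_space prob_space_uniform_measure) auto

lemma rt_deterministic:
  assumes "\<And>h. B h \<noteq> Query"
  shows "rt x n B v s b = rt x n B v' s b"
  using assms
proof (induction n arbitrary: B v v' s b)
  case (Suc n)
  have "observe (B []) u s = observe (B []) u' s" for u u'
    using Suc.prems[of "[]"] by (cases "B []"; cases s) auto
  moreover have "after B z h \<noteq> Query" for z h unfolding after_def by (rule Suc.prems)
  ultimately show ?case unfolding rt.simps(2) using Suc.IH by metis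
qed simp

lemma reach_time_deterministic:
  assumes "\<And>h. ok (B h)"
  shows "reach_time B x \<omega> = reach x B (sconst 0) start (fst \<omega>)"
proof -
  have "reach_time B x (fst \<omega>, snd \<omega>) = reach x B (snd \<omega>) start (fst \<omega>)"
    by (rule reach_time_eq_reach) (use assms in \<open>auto simp: ok_def\<close>)
  also have "\<dots> = reach x B (sconst 0) start (fst \<omega>)"
    unfolding reach_def by (intro INF_cong refl rt_deterministic) (use assms in \<open>auto simp: ok_def\<close>)
  finally show ?thesis by simp
qed

lemma faulty_agent_ok:
  assumes "\<And>h. ok (B h)"
  shows "faulty_agent p B" "deterministic B"
proof -
  have "reach_time B x \<in> borel_measurable (chance p)" for x
    unfolding reach_time_deterministic[of B, OF assms, abs_def] chance_eq by measurable
  then show "faulty_agent p B" "deterministic B"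
    using assms unfolding faulty_agent_def deterministic_def ok_def by auto
qed

lemma SUP_min_of_nat: "(SUP M. min (of_nat M) t) = (t :: ennreal)"
proof (rule antisym)
  show "t \<le> (SUP M. min (of_nat M) t)"
  proof (rule dense_le)
    fix u assume u: "u < t"
    then obtain n where "u \<le> of_nat n"
      using ennreal_Ex_less_of_nat[of u] less_le_trans[OF u top_greatest] by (auto intro: less_imp_le)
    then have "u \<le> min (of_nat n) t" using u by simp
    then show "u \<le> (SUP M. min (of_nat M) t)" by (rule SUP_upper2[rotated]) simp
  qed
qed (auto intro: SUP_least)

lemma expected_time_le:
  assumes "\<And>h. ok (B h)" and "\<And>M :: nat. val x M B start \<le> c" and "0 \<le> c"
  shows "expected_time p B x \<le> ennreal c"
proof -
  interpret samples: prob_space samples by (rule prob_space_samples)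
  let ?r = "reach x B (sconst 0) start"
  have "expected_time p B x = (\<integral>\<^sup>+\<omega>. ?r (fst \<omega>) \<partial>(faults \<Otimes>\<^sub>M samples))"
    unfolding expected_time_def chance_eq by (intro nn_integral_cong reach_time_deterministic assms)
  also have "\<dots> = (\<integral>\<^sup>+b. \<integral>\<^sup>+v. ?r b \<partial>samples \<partial>faults)"
    by (subst samples.nn_integral_fst[symmetric]) auto
  also have "\<dots> = (\<integral>\<^sup>+b. (SUP M. min (of_nat M) (?r b)) \<partial>faults)"
    by (simp add: SUP_min_of_nat samples.emeasure_space_1)
  also have "\<dots> = (SUP M. \<integral>\<^sup>+b. min (of_nat M) (?r b) \<partial>faults)"
    by (rule nn_integral_monotone_convergence_SUP)
      (auto simp: incseq_def le_fun_def intro: min.coboundedI1)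
  also have "\<dots> \<le> ennreal c"
  proof (rule SUP_least)
    fix M :: nat
    have "(\<integral>\<^sup>+b. min (of_nat M) (?r b) \<partial>faults) = (\<integral>\<^sup>+b. ennreal (trunc M (?r b)) \<partial>faults)"
      by (simp add: ennreal_trunc ennreal_of_nat_eq_real_of_nat)
    also have "\<dots> = ennreal (val x M B start)"
      unfolding val_def by (rule ennreal_EB[symmetric, where M = M]) (auto simp: trunc_bounds)
    also have "\<dots> \<le> ennreal c" by (intro ennreal_leI assms)
    finally show "(\<integral>\<^sup>+b. min (of_nat M) (?r b) \<partial>faults) \<le> ennreal c" .
  qed
  finally show ?thesis .
qed

end

section \<open>Replacing the oracle by finitely many bits\<close>

text \<open>
  The points are chosen one after the other, each time such that the sum of the squared deviations
  grows by no more than its expected increase under an independent random choice.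
\<close>

lemma exists_sampling:
  fixes f :: "'i \<Rightarrow> 'v \<Rightarrow> real" and P :: "'w \<Rightarrow> real" and S :: real
  assumes "prob_space U" and "finite I" and "finite \<Omega>"
    and meas: "\<And>i. i \<in> I \<Longrightarrow> f i \<in> borel_measurable U"
    and bounds: "\<And>i u. i \<in> I \<Longrightarrow> 0 \<le> f i u" "\<And>i u. i \<in> I \<Longrightarrow> f i u \<le> S"
  shows "\<exists>v. (\<Sum>i\<in>I. (\<Sum>w\<in>\<Omega>. P w * (f i (v w) - (\<integral>u. f i u \<partial>U)))\<^sup>2)
    \<le> (\<Sum>w\<in>\<Omega>. (P w)\<^sup>2) * (card I * S\<^sup>2)"
  using \<open>finite \<Omega>\<close>
proof induction
  case (insert w \<Omega>)
  interpret prob_space U by fact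
  let ?m = "\<lambda>i. \<integral>u. f i u \<partial>U"
  obtain v where v: "(\<Sum>i\<in>I. (\<Sum>w\<in>\<Omega>. P w * (f i (v w) - ?m i))\<^sup>2)
    \<le> (\<Sum>w\<in>\<Omega>. (P w)\<^sup>2) * (card I * S\<^sup>2)"
    using insert by blast
  define a where "a = (\<lambda>i. \<Sum>w\<in>\<Omega>. P w * (f i (v w) - ?m i))"
  \<comment> \<open>The sum of squared deviations that results from choosing the point
    \<open>u\<close> for the new index \<open>w\<close>.\<close>
  define g where "g = (\<lambda>u. \<Sum>i\<in>I. (a i + P w * (f i u - ?m i))\<^sup>2)"
  have int: "integrable U (f i)" if "i \<in> I" for i
    by (rule integrable_const_bound[where B = S]) (use meas bounds that in auto)
  have m: "0 \<le> ?m i" "?m i \<le> S" if "i \<in> I" for i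
    using integral_ge_const[OF int[OF that], of 0] integral_le_const[OF int[OF that], of S] bounds that by auto
  have sq: "(f i u - ?m i)\<^sup>2 \<le> S\<^sup>2" if "i \<in> I" for i u
  proof -
    have "\<bar>f i u - ?m i\<bar> \<le> \<bar>S\<bar>"
      using m[OF that] bounds[OF that, of u] by (auto simp: abs_le_iff)
    then show ?thesis by (simp add: abs_le_square_iff)
  qed
  have int_sq: "integrable U (\<lambda>u. (f i u - ?m i)\<^sup>2)" if "i \<in> I" for i
    by (rule integrable_const_bound[where B = "S\<^sup>2"]) (use meas sq that in auto)
  have expand: "(a i + P w * (f i u - ?m i))\<^sup>2 =
    (a i)\<^sup>2 + 2 * a i * P w * (f i u - ?m i) + (P w)\<^sup>2 * (f i u - ?m i)\<^sup>2" for i u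
    by (simp add: power2_eq_square algebra_simps)
  have int_i: "integrable U (\<lambda>u. (a i + P w * (f i u - ?m i))\<^sup>2)" if "i \<in> I" for i
    unfolding expand using int[OF that] int_sq[OF that] by auto
  have g_int: "integrable U g"
    unfolding g_def using int_i by auto
  \<comment> \<open>Under a random \<open>u\<close> the cross term has mean 0, so only the variance
    term is added to the old deviation.\<close>
  have mean_sq: "(\<integral>u. (a i + P w * (f i u - ?m i))\<^sup>2 \<partial>U) \<le> (a i)\<^sup>2 + (P w)\<^sup>2 * S\<^sup>2" if "i \<in> I" for i
  proof -
    have "(\<integral>u. (a i + P w * (f i u - ?m i))\<^sup>2 \<partial>U) =
      (a i)\<^sup>2 + 2 * a i * P w * (\<integral>u. f i u - ?m i \<partial>U) + (P w)\<^sup>2 * (\<integral>u. (f i u - ?m i)\<^sup>2 \<partial>U)"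
      unfolding expand using int[OF that] int_sq[OF that] by (simp add: prob_space)
    also have "(\<integral>u. f i u - ?m i \<partial>U) = 0" using int[OF that] by (simp add: prob_space)
    also have "(\<integral>u. (f i u - ?m i)\<^sup>2 \<partial>U) \<le> S\<^sup>2"
      using int_sq[OF that] sq[OF that] by (intro integral_le_const) auto
    finally show ?thesis by (simp add: mult_left_mono)
  qed
  have "(\<integral>u. g u \<partial>U) = (\<Sum>i\<in>I. \<integral>u. (a i + P w * (f i u - ?m i))\<^sup>2 \<partial>U)"
    unfolding g_def using int_i by (intro Bochner_Integration.integral_sum)
  also have "\<dots> \<le> (\<Sum>i\<in>I. (a i)\<^sup>2 + (P w)\<^sup>2 * S\<^sup>2)" by (intro sum_mono mean_sq)
  also have "\<dots> \<le> (\<Sum>w\<in>\<Omega>. (P w)\<^sup>2) * (card I * S\<^sup>2) + (P w)\<^sup>2 * (card I * S\<^sup>2)"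
    using v unfolding a_def by (simp add: sum.distrib algebra_simps)
  also have "\<dots> = (\<Sum>w\<in>insert w \<Omega>. (P w)\<^sup>2) * (card I * S\<^sup>2)"
    using insert by (simp add: algebra_simps)
  finally have E: "(\<integral>u. g u \<partial>U) \<le> (\<Sum>w\<in>insert w \<Omega>. (P w)\<^sup>2) * (card I * S\<^sup>2)" (is "_ \<le> ?b") .
  have "\<exists>u. g u \<le> ?b"
  proof (rule ccontr)
    assume "\<nexists>u. g u \<le> ?b"
    then have "?b < (\<integral>u. g u \<partial>U)"
      by (intro expectation_greater g_int) (auto simp: not_le)
    then show False using E by simp
  qed
  then obtain u where u: "g u \<le> ?b" ..
  have "(\<Sum>w'\<in>insert w \<Omega>. P w' * (f i ((v(w := u)) w') - ?m i)) = a i + P w * (f i u - ?m i)" for i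
  proof -
    have "(\<Sum>w'\<in>\<Omega>. P w' * (f i ((v(w := u)) w') - ?m i)) = a i"
      unfolding a_def by (intro sum.cong) (use insert in auto)
    then show ?thesis using insert by simp
  qed
  then show ?case using u unfolding g_def by (intro exI[of _ "v(w := u)"]) (simp only:)
qed simp

context faulty
begin

text \<open>The mean over \<open>U\<close> is imitated by one table \<open>v\<close> that assigns a
  point to each word, with the same error bound for all \<open>i\<close> in the finite set
  \<open>I\<close>. Long words make the sum of squared weights beat the factor
  \<open>card I * S\<^sup>2\<close>.\<close>

lemma sampling_bits:
  fixes f :: "'i \<Rightarrow> 'v \<Rightarrow> real"
  assumes "prob_space U" and "finite I" and "0 < e"
    and "\<And>i. i \<in> I \<Longrightarrow> f i \<in> borel_measurable U"
    and "\<And>i u. i \<in> I \<Longrightarrow> 0 \<le> f i u" "\<And>i u. i \<in> I \<Longrightarrow> f i u \<le> S"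
  shows "\<exists>N v. \<forall>i\<in>I. \<bar>(\<Sum>bs\<in>words N. wt bs * f i (v bs)) - (\<integral>u. f i u \<partial>U)\<bar> \<le> e"
proof -
  define q where "q = p\<^sup>2 + (1 - p)\<^sup>2"
  \<comment> \<open>Indeed \<open>q = 1 - 2 * p * (1 - p)\<close>.\<close>
  have "0 < p * (1 - p)" using p_pos p_less_half by simp
  then have "q < 1" unfolding q_def by (simp add: power2_eq_square algebra_simps)
  moreover have "0 \<le> q" unfolding q_def by simp
  ultimately have q: "0 \<le> q" "q < 1" by auto
  have "(\<lambda>N. q ^ N * (card I * S\<^sup>2)) \<longlonglongrightarrow> 0 * (card I * S\<^sup>2)"
    using q by (intro tendsto_intros LIMSEQ_realpow_zero)
  then have "eventually (\<lambda>N. q ^ N * (card I * S\<^sup>2) < e\<^sup>2) sequentially"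
    using assms(3) by (intro order_tendstoD(2)) auto
  then obtain N where N: "q ^ N * (card I * S\<^sup>2) < e\<^sup>2"
    by (auto simp: eventually_sequentially)
  obtain v where v: "(\<Sum>i\<in>I. (\<Sum>bs\<in>words N. wt bs * (f i (v bs) - (\<integral>u. f i u \<partial>U)))\<^sup>2)
    \<le> q ^ N * (card I * S\<^sup>2)"
    using exists_sampling[where U = U and I = I and \<Omega> = "words N" and f = f and S = S and P = wt] assms
    unfolding sum_wt_squared q_def by auto
  have "\<bar>(\<Sum>bs\<in>words N. wt bs * f i (v bs)) - (\<integral>u. f i u \<partial>U)\<bar> \<le> e" if "i \<in> I" for i
  proof -
    have "(\<Sum>bs\<in>words N. wt bs * f i (v bs)) - (\<integral>u. f i u \<partial>U) =
      (\<Sum>bs\<in>words N. wt bs * (f i (v bs) - (\<integral>u. f i u \<partial>U)))" (is "?d = _")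
      by (simp add: right_diff_distrib sum_subtractf sum_wt flip: sum_distrib_right)
    then have "?d\<^sup>2 \<le> (\<Sum>i\<in>I. (\<Sum>bs\<in>words N. wt bs * (f i (v bs) - (\<integral>u. f i u \<partial>U)))\<^sup>2)"
      using that assms(2) by (auto intro: member_le_sum)
    then have "?d\<^sup>2 \<le> e\<^sup>2" using v N by simp
    then show ?thesis using assms(3) by (simp add: abs_le_square_iff[symmetric])
  qed
  then show ?thesis by blast
qed

section \<open>Convergence as the number of steps grows\<close>

lemma trunc_tendsto:
  assumes "0 \<le> S" "(f \<longlongrightarrow> t) F"
  shows "((\<lambda>n. trunc S (f n)) \<longlongrightarrow> trunc S t) F"
proof -
  have "((\<lambda>n. min (ennreal S) (f n)) \<longlongrightarrow> ennreal (trunc S t)) F"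
    unfolding ennreal_trunc[OF assms(1)] using assms(2) by (intro tendsto_intros)
  then show ?thesis unfolding trunc_def
    by (rule tendsto_enn2real) simp
qed

text \<open>\<open>late S\<close> jumps at \<open>S\<close>, but along a decreasing sequence this is
  harmless: a limit below \<open>S\<close> forces the sequence below \<open>S\<close> eventually,
  and a limit of at least \<open>S\<close> keeps all members there.\<close>

lemma late_tendsto:
  assumes "decseq f"
  shows "(\<lambda>n. late S (f n)) \<longlonglongrightarrow> late S (INF n. f n)"
proof (cases "(INF n. f n) < ennreal S")
  case True
  have "eventually (\<lambda>n. f n < ennreal S) sequentially"
    using order_tendstoD(2)[OF LIMSEQ_INF[OF assms] True] .
  then have "eventually (\<lambda>n. late S (f n) = 0) sequentially"
    by eventually_elim (simp add: late_def)
  then show ?thesis using True by (simp add: late_def tendsto_eventually)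
next
  case False
  have "\<not> f n < ennreal S" for n
    using False INF_lower[of n UNIV f] by (auto simp: not_less intro: order_trans)
  then show ?thesis using False by (simp add: late_def)
qed

lemma EB_tendsto:
  assumes "\<And>n. Fmeas (f n)" "Fmeas g" "\<And>b. (\<lambda>n. f n b) \<longlonglongrightarrow> g b" "\<And>n b. 0 \<le> f n b" "\<And>n b. f n b \<le> M"
  shows "(\<lambda>n. EB (f n)) \<longlonglongrightarrow> EB g"
  unfolding EB_def
  by (rule integral_dominated_convergence[where w = "\<lambda>_. M"]) (use assms in auto)

section \<open>The given agent averaged over faults and oracle answers\<close>

context
  fixes A :: agent
  assumes A: "faulty_agent p A"
begin

lemma A_admissible: "admissible (A h)"
  using A unfolding faulty_agent_def by blast

lemma A_reach_time: "reach_time A x (b, v) = reach x A v start b"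
  by (rule reach_time_eq_reach[OF A_admissible])

lemma A_measurable [measurable]: "reach_time A x \<in> borel_measurable (faults \<Otimes>\<^sub>M samples)"
  using A unfolding faulty_agent_def chance_eq by blast

lemma mean_chance:
  assumes [measurable]: "h \<in> borel_measurable borel" and "\<And>t. 0 \<le> h t" "\<And>t. h t \<le> (S :: real)"
  shows "(\<lambda>v. EB (\<lambda>b. h (reach x A v start b))) \<in> borel_measurable samples"
    and "(\<integral>v. EB (\<lambda>b. h (reach x A v start b)) \<partial>samples) = (\<integral>\<omega>. h (reach_time A x \<omega>) \<partial>chance p)"
proof -
  interpret samples: prob_space samples by (rule prob_space_samples)
  interpret pair_prob_space faults samples ..
  have "(\<lambda>(v, b). h (reach_time A x (b, v))) \<in> borel_measurable (samples \<Otimes>\<^sub>M faults)"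
    by measurable
  then show "(\<lambda>v. EB (\<lambda>b. h (reach x A v start b))) \<in> borel_measurable samples"
    unfolding EB_def A_reach_time[symmetric] by (intro faults.borel_measurable_lebesgue_integral)
  have "integrable (faults \<Otimes>\<^sub>M samples) (\<lambda>\<omega>. h (reach_time A x \<omega>))"
    by (rule integrable_const_bound[where B = S]) (use assms in auto)
  then have "integrable (faults \<Otimes>\<^sub>M samples) (case_prod (\<lambda>b v. h (reach_time A x (b, v))))"
    by (simp add: case_prod_beta')
  from integral_snd[OF this]
  show "(\<integral>v. EB (\<lambda>b. h (reach x A v start b)) \<partial>samples) = (\<integral>\<omega>. h (reach_time A x \<omega>) \<partial>chance p)"
    unfolding EB_def A_reach_time[symmetric] chance_eq by (simp add: case_prod_beta')
qed

definition late_prob :: "real \<Rightarrow> real \<Rightarrow> real" where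
  "late_prob S x = (\<integral>\<omega>. late S (reach_time A x \<omega>) \<partial>chance p)"

definition trunc_time :: "real \<Rightarrow> real \<Rightarrow> real" where
  "trunc_time S x = (\<integral>\<omega>. trunc S (reach_time A x \<omega>) \<partial>chance p)"

lemma trunc_time_le:
  assumes "0 \<le> S" "expected_time p A x \<le> ennreal c" "0 \<le> c"
  shows "trunc_time S x \<le> c"
proof -
  interpret samples: prob_space samples by (rule prob_space_samples)
  interpret pair_prob_space faults samples ..
  have "integrable (faults \<Otimes>\<^sub>M samples) (\<lambda>\<omega>. trunc S (reach_time A x \<omega>))"
    by (rule integrable_const_bound[where B = S]) (use trunc_bounds assms in auto)
  then have "ennreal (trunc_time S x) = (\<integral>\<^sup>+\<omega>. ennreal (trunc S (reach_time A x \<omega>)) \<partial>chance p)"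
    unfolding trunc_time_def chance_eq using assms(1)
    by (intro nn_integral_eq_integral[symmetric]) (auto simp: trunc_bounds)
  also have "\<dots> \<le> expected_time p A x"
    unfolding expected_time_def by (intro nn_integral_mono) (simp add: ennreal_trunc assms(1))
  also have "\<dots> \<le> ennreal c" by fact
  finally show ?thesis using assms(3) by simp
qed

text \<open>The factor \<open>n\<close> is essential since a miss at deadline \<open>n\<close> costs
  a return of order \<open>n\<close>. It is gained from integrability: \<open>n * late n\<close> is
  dominated by the reaching time itself and is eventually 0 wherever that time is finite.\<close>

lemma late_prob_tendsto:
  assumes "expected_time p A x \<le> ennreal c"
  shows "(\<lambda>n. real n * late_prob (real n) x) \<longlonglongrightarrow> 0"
proof -
  let ?r = "reach_time A x"
  have [measurable]: "?r \<in> borel_measurable (chance p)" using A unfolding faulty_agent_def by blast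
  have fin: "(\<integral>\<^sup>+\<omega>. ?r \<omega> \<partial>chance p) < \<infinity>"
    using assms unfolding expected_time_def by (auto intro: le_less_trans)
  then have AE: "AE \<omega> in chance p. ?r \<omega> \<noteq> \<infinity>"
    by (intro nn_integral_noteq_infinite) auto
  have "integrable (chance p) (\<lambda>\<omega>. enn2real (?r \<omega>))"
  proof (rule integrableI_nonneg)
    have "(\<integral>\<^sup>+\<omega>. ennreal (enn2real (?r \<omega>)) \<partial>chance p) \<le> (\<integral>\<^sup>+\<omega>. ?r \<omega> \<partial>chance p)"
      by (intro nn_integral_mono) (metis ennreal_enn2real_if top_greatest order_refl)
    then show "(\<integral>\<^sup>+\<omega>. ennreal (enn2real (?r \<omega>)) \<partial>chance p) < \<infinity>" using fin by simp
  qed auto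
  moreover have "AE \<omega> in chance p. (\<lambda>n. real n * late (real n) (?r \<omega>)) \<longlonglongrightarrow> 0"
    using AE
  proof eventually_elim
    case (elim \<omega>)
    then obtain k where k: "?r \<omega> < of_nat k"
      using ennreal_Ex_less_of_nat[of "?r \<omega>"] by (auto simp: less_top)
    have "eventually (\<lambda>n. real n * late (real n) (?r \<omega>) = 0) sequentially"
      using eventually_ge_at_top[of k]
    proof eventually_elim
      case (elim n)
      have "(of_nat k :: ennreal) \<le> of_nat n" using elim by simp
      then have "?r \<omega> < ennreal (real n)"
        using k unfolding ennreal_of_nat_eq_real_of_nat by (rule less_le_trans[rotated])
      then show ?case by (simp add: late_def)
    qed
    then show ?case by (rule tendsto_eventually)
  qed
  moreover have "AE \<omega> in chance p. norm (real n * late (real n) (?r \<omega>)) \<le> enn2real (?r \<omega>)" for n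
    using AE
  proof eventually_elim
    case (elim \<omega>)
    then show ?case
      using late_le_trunc[of "real n" "?r \<omega>"] late_bounds(1)[of "real n" "?r \<omega>"]
        enn2real_mono[of "min (ennreal (real n)) (?r \<omega>)" "?r \<omega>"]
      by (auto simp: trunc_def less_top)
  qed
  ultimately have "(\<lambda>n. \<integral>\<omega>. real n * late (real n) (?r \<omega>) \<partial>chance p) \<longlonglongrightarrow> (\<integral>\<omega>. 0 \<partial>chance p)"
    by (intro integral_dominated_convergence[where w = "\<lambda>\<omega>. enn2real (?r \<omega>)"]) auto
  then show ?thesis by (simp add: late_prob_def)
qed

lemma exists_phase:
  assumes Z: "finite Z" and S: "0 < S" and e: "0 < e"
  shows "\<exists>N D n v. 0 < D \<and> (real N + 1) * (1 + C) * D \<le> 1 \<and> (\<forall>z\<in>Z.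
    (\<Sum>bs\<in>words N. wt bs * EB (\<lambda>b. trunc S (rt z n A (v bs) start b))) \<le> trunc_time S z + e \<and>
    (\<Sum>bs\<in>words N. wt bs * EB (\<lambda>b. late S (rt z n A (v bs) start b))) \<le> late_prob S z + e)"
proof -
  \<comment> \<open>Indexing both functionals by a truth value lets a single application of the
    sampling lemma serve the truncated time and the miss probability with the same table. Half of
    the error \<open>e\<close> goes to sampling, the rest to the restriction to \<open>n\<close>
    steps.\<close>
  define h where "h = (\<lambda>c. if c then trunc S else late S)"
  define M where "M = max S 1"
  have h [measurable]: "h c \<in> borel_measurable borel" and h_bounds: "0 \<le> h c t" "h c t \<le> M" for c t
    using S trunc_bounds[of S t] late_bounds[of S t] by (auto simp: h_def M_def)
  define f where "f = (\<lambda>(z, c) v. EB (\<lambda>b. h c (reach z A v start b)))"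
  have f_le: "EB (\<lambda>b. h c (reach z A v start b)) \<le> M" for z c v
    using EB_mono[of "\<lambda>b. h c (reach z A v start b)" "\<lambda>_. M" M] h_bounds by simp
  have "\<exists>N v. \<forall>i\<in>Z \<times> UNIV. \<bar>(\<Sum>bs\<in>words N. wt bs * f i (v bs)) - (\<integral>u. f i u \<partial>samples)\<bar> \<le> e / 2"
  proof (rule sampling_bits[OF prob_space_samples, where S = M])
    fix i u assume "i \<in> Z \<times> (UNIV :: bool set)"
    then show "f i \<in> borel_measurable samples" "0 \<le> f i u" "f i u \<le> M"
      unfolding f_def using mean_chance(1)[OF h h_bounds]
      by (auto simp: case_prod_beta intro!: EB_nonneg h_bounds f_le)
  qed (use Z e in auto)
  then obtain N v where v: "\<And>z c. z \<in> Z \<Longrightarrow>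
    \<bar>(\<Sum>bs\<in>words N. wt bs * EB (\<lambda>b. h c (reach z A (v bs) start b))) - (\<integral>\<omega>. h c (reach_time A z \<omega>) \<partial>chance p)\<bar> \<le> e / 2"
    unfolding f_def using mean_chance(2)[OF h h_bounds] by fastforce
  have lim: "(\<lambda>n. EB (\<lambda>b. h c (rt z n A w start b))) \<longlonglongrightarrow> EB (\<lambda>b. h c (reach z A w start b))" for c z w
  proof (rule EB_tendsto[where M = M])
    fix b
    show "(\<lambda>n. h c (rt z n A w start b)) \<longlonglongrightarrow> h c (reach z A w start b)"
      using S trunc_tendsto[OF _ LIMSEQ_INF[OF decseq_rt]] late_tendsto[OF decseq_rt]
      by (simp add: h_def reach_def)
  qed (use h_bounds in auto)
  have "eventually (\<lambda>n. (\<Sum>bs\<in>words N. wt bs * EB (\<lambda>b. h c (rt z n A (v bs) start b))) <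
      (\<integral>\<omega>. h c (reach_time A z \<omega>) \<partial>chance p) + e) sequentially" if "z \<in> Z" for z c
  proof (rule order_tendstoD(2))
    show "(\<lambda>n. \<Sum>bs\<in>words N. wt bs * EB (\<lambda>b. h c (rt z n A (v bs) start b))) \<longlonglongrightarrow>
      (\<Sum>bs\<in>words N. wt bs * EB (\<lambda>b. h c (reach z A (v bs) start b)))"
      by (intro tendsto_intros lim)
  qed (use v[OF that, of c] e in linarith)
  then have "eventually (\<lambda>n. \<forall>z\<in>Z. \<forall>c. (\<Sum>bs\<in>words N. wt bs * EB (\<lambda>b. h c (rt z n A (v bs) start b))) <
      (\<integral>\<omega>. h c (reach_time A z \<omega>) \<partial>chance p) + e) sequentially"
    using Z by (auto intro!: eventually_ball_finite eventually_all_finite)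
  then obtain n where n: "\<forall>z\<in>Z. \<forall>c. (\<Sum>bs\<in>words N. wt bs * EB (\<lambda>b. h c (rt z n A (v bs) start b))) <
      (\<integral>\<omega>. h c (reach_time A z \<omega>) \<partial>chance p) + e"
    by (auto simp: eventually_sequentially)
  \<comment> \<open>Chosen last, since the estimates for excursions hold at every scale:
    \<open>N\<close> bits and one possible reversal then cost at most 1.\<close>
  define D where "D = 1 / ((real N + 1) * (1 + C))"
  have "0 < (real N + 1) * (1 + C)" using C_props(1) by simp
  then have D: "0 < D" "(real N + 1) * (1 + C) * D \<le> 1" unfolding D_def by auto
  show ?thesis
  proof (intro exI conjI ballI)
    fix z assume z: "z \<in> Z"
    show "(\<Sum>bs\<in>words N. wt bs * EB (\<lambda>b. trunc S (rt z n A (v bs) start b))) \<le> trunc_time S z + e"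
      using n[rule_format, OF z, of True] by (simp add: h_def trunc_time_def)
    show "(\<Sum>bs\<in>words N. wt bs * EB (\<lambda>b. late S (rt z n A (v bs) start b))) \<le> late_prob S z + e"
      using n[rule_format, OF z, of False] by (simp add: h_def late_prob_def)
  qed (use D in auto)
qed

end

end

section \<open>The deterministic agent\<close>

context faulty
begin

lemma sum_wt_bounds:
  assumes "\<And>bs. 0 \<le> f bs" "\<And>bs. f bs \<le> c"
  shows "0 \<le> (\<Sum>bs\<in>words N. wt bs * f bs)" "(\<Sum>bs\<in>words N. wt bs * f bs) \<le> c"
proof -
  show "0 \<le> (\<Sum>bs\<in>words N. wt bs * f bs)"
    using assms wt_pos by (intro sum_nonneg mult_nonneg_nonneg) (auto intro: less_imp_le)
  have "(\<Sum>bs\<in>words N. wt bs * f bs) \<le> (\<Sum>bs\<in>words N. wt bs * c)"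
    using assms wt_pos by (intro sum_mono mult_left_mono) (auto intro: less_imp_le)
  then show "(\<Sum>bs\<in>words N. wt bs * f bs) \<le> c" by (simp add: sum_wt flip: sum_distrib_right)
qed

definition causal :: "(agent \<Rightarrow> agent) \<Rightarrow> bool" where
  "causal P \<longleftrightarrow>
    (\<forall>K K' h. (\<forall>h'. length h' < length h \<longrightarrow> K h' = K' h') \<longrightarrow> P K h = P K' h) \<and>
    (\<forall>K h. (\<forall>h'. length h' < length h \<longrightarrow> ok (K h')) \<longrightarrow> ok (P K h))"

definition origin_le :: "real \<Rightarrow> real \<Rightarrow> agent \<Rightarrow> real \<Rightarrow> bool" where
  "origin_le x M K W \<longleftrightarrow> (\<forall>\<sigma>. \<sigma> = 1 \<or> \<sigma> = -1 \<longrightarrow> val x M K (0, \<sigma>, True) \<le> W)"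

lemma origin_leD: "origin_le x M K W \<Longrightarrow> \<sigma> = 1 \<or> \<sigma> = -1 \<Longrightarrow> val x M K (0, \<sigma>, True) \<le> W"
  unfolding origin_le_def by blast

lemma origin_le_mono: "origin_le x M K W \<Longrightarrow> W \<le> W' \<Longrightarrow> origin_le x M K W'"
  unfolding origin_le_def by fastforce

text \<open>The three bounds are for deadlines far below, comparable to, and far above the distance
  of the target. They use, in turn, only the deadline, Markov's inequality, and a miss probability
  small compared with \<open>1 / S\<close>; only the last one discounts the future \<open>W\<close>
  by a factor \<open>\<delta>\<close>.\<close>

lemma exists_phase_agent:
  assumes A: "faulty_agent p A" and Z: "finite Z" and S: "1 \<le> S" and \<delta>: "0 < \<delta>" "\<delta> \<le> 1"
  shows "\<exists>P. causal P \<and> (\<forall>x M K W. 0 \<le> M \<longrightarrow> x \<noteq> 0 \<longrightarrow> origin_le x M K W \<longrightarrow>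
      origin_le x M (P K) (1 + (2 + 2 * C) * S + W) \<and>
      (\<forall>c. x \<in> Z \<longrightarrow> - x \<in> Z \<longrightarrow> trunc_time A S x \<le> c \<longrightarrow> trunc_time A S (- x) \<le> c \<longrightarrow>
        origin_le x M (P K) (1 + (2 + 2 * C) * (c + 1) + W) \<and>
        (S * late_prob A S x \<le> \<delta> / 2 \<longrightarrow> S * late_prob A S (- x) \<le> \<delta> / 2 \<longrightarrow>
         origin_le x M (P K) (2 + c + (1 + 2 * C) * \<delta> + \<delta> * W))))"
proof -
  \<comment> \<open>Then \<open>S * e = \<delta> / 2\<close>, which together with
    \<open>S * late_prob \<le> \<delta> / 2\<close> gives at most \<open>\<delta>\<close> for
    \<open>S\<close> times the probability of a miss.\<close>
  define e where "e = \<delta> / (2 * S)"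
  have e: "0 < e" "e \<le> 1" "S * e = \<delta> / 2" using S \<delta> by (auto simp: e_def divide_le_eq)
  have S0: "0 < S" "0 \<le> S" using S by auto
  obtain N D n v where D: "0 < D" "(real N + 1) * (1 + C) * D \<le> 1"
    and *: "\<And>z. z \<in> Z \<Longrightarrow>
      (\<Sum>bs\<in>words N. wt bs * EB (\<lambda>b. trunc S (rt z n A (v bs) start b))) \<le> trunc_time A S z + e \<and>
      (\<Sum>bs\<in>words N. wt bs * EB (\<lambda>b. late S (rt z n A (v bs) start b))) \<le> late_prob A S z + e"
    using exists_phase[OF A Z S0(1) e(1)] by blast
  note adm = A_admissible[OF A]
  define P where "P = phase N D n S A v"
  have rel: "Q (P K h) (P K' h)"
    if "\<And>a. ok a \<Longrightarrow> Q a a" "\<And>h'. length h' < length h \<Longrightarrow> Q (K h') (K' h')" for Q K K' h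
    unfolding P_def by (rule phase_rel[where Q = Q, OF that(1) adm S0(2) less_imp_le[OF D(1)] that(2)])
  have causal: "causal P"
    unfolding causal_def using rel[of "(=)"] rel[of "\<lambda>a _. ok a"] by blast
  have main: "val x M (P K) (0, \<sigma>, True) \<le> 1 + (2 + 2 * C) * S + W \<and>
      (\<forall>c. x \<in> Z \<longrightarrow> - x \<in> Z \<longrightarrow> trunc_time A S x \<le> c \<longrightarrow> trunc_time A S (- x) \<le> c \<longrightarrow>
        val x M (P K) (0, \<sigma>, True) \<le> 1 + (2 + 2 * C) * (c + 1) + W \<and>
        (S * late_prob A S x \<le> \<delta> / 2 \<longrightarrow> S * late_prob A S (- x) \<le> \<delta> / 2 \<longrightarrow>
         val x M (P K) (0, \<sigma>, True) \<le> 2 + c + (1 + 2 * C) * \<delta> + \<delta> * W))"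
    if M: "0 \<le> M" and x: "x \<noteq> 0" and W: "origin_le x M K W" and \<sigma>: "\<sigma> = 1 \<or> \<sigma> = -1" for x M K W \<sigma>
  proof -
    have W0: "0 \<le> W" using origin_leD[OF W, of 1] val_nonneg[OF M, of x K "(0, 1, True)"] by simp
    have "\<exists>\<tau>. (\<tau> = 1 \<or> \<tau> = -1) \<and> val x M (P K) (0, \<sigma>, True) \<le> (real N + 1) * (1 + C) * D +
      (\<Sum>bs\<in>words N. wt bs * EB (\<lambda>b. trunc S (rt (\<tau> * x) n A (v bs) start b))) +
      ((1 + 2 * C) * S + W) * (\<Sum>bs\<in>words N. wt bs * EB (\<lambda>b. late S (rt (\<tau> * x) n A (v bs) start b)))"
      unfolding P_def by (rule val_phase[OF M x adm D(1) S0(1) \<sigma> origin_leD[OF W]])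
    then obtain \<tau> where \<tau>: "\<tau> = 1 \<or> \<tau> = -1" and v: "val x M (P K) (0, \<sigma>, True) \<le> (real N + 1) * (1 + C) * D +
      (\<Sum>bs\<in>words N. wt bs * EB (\<lambda>b. trunc S (rt (\<tau> * x) n A (v bs) start b))) +
      ((1 + 2 * C) * S + W) * (\<Sum>bs\<in>words N. wt bs * EB (\<lambda>b. late S (rt (\<tau> * x) n A (v bs) start b)))"
      by (elim exE conjE)
    define a where "a = (\<Sum>bs\<in>words N. wt bs * EB (\<lambda>b. trunc S (rt (\<tau> * x) n A (v bs) start b)))"
    define q where "q = (\<Sum>bs\<in>words N. wt bs * EB (\<lambda>b. late S (rt (\<tau> * x) n A (v bs) start b)))"
    have tr: "0 \<le> EB (\<lambda>b. trunc S (f b))" "EB (\<lambda>b. trunc S (f b)) \<le> S"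
      and la: "0 \<le> EB (\<lambda>b. late S (f b))" "EB (\<lambda>b. late S (f b)) \<le> 1"
      and lt: "S * EB (\<lambda>b. late S (f b)) \<le> EB (\<lambda>b. trunc S (f b))"
      if [measurable]: "f \<in> borel_measurable faults" for f
    proof -
      show "0 \<le> EB (\<lambda>b. trunc S (f b))" "0 \<le> EB (\<lambda>b. late S (f b))"
        by (intro EB_nonneg trunc_bounds late_bounds S0)+
      show "EB (\<lambda>b. trunc S (f b)) \<le> S" "EB (\<lambda>b. late S (f b)) \<le> 1"
        using EB_mono[of "\<lambda>b. trunc S (f b)" "\<lambda>_. S" S] EB_mono[of "\<lambda>b. late S (f b)" "\<lambda>_. 1" 1]
        by (auto simp: trunc_bounds late_bounds S0)
      have "S * EB (\<lambda>b. late S (f b)) = EB (\<lambda>b. S * late S (f b))" by (simp add: EB_def)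
      also have "\<dots> \<le> EB (\<lambda>b. trunc S (f b))"
        by (rule EB_mono[where M = S]) (auto simp: trunc_bounds late_bounds S0 late_le_trunc)
      finally show "S * EB (\<lambda>b. late S (f b)) \<le> EB (\<lambda>b. trunc S (f b))" .
    qed
    have a: "a \<le> S" and q: "0 \<le> q" "q \<le> 1"
      unfolding a_def q_def
      by (rule sum_wt_bounds(2) sum_wt_bounds(1)[where c = 1], (intro tr la rt_measurable)+)+
    have "S * q = (\<Sum>bs\<in>words N. wt bs * (S * EB (\<lambda>b. late S (rt (\<tau> * x) n A (v bs) start b))))"
      unfolding q_def by (simp add: sum_distrib_left algebra_simps)
    also have "\<dots> \<le> a"
      unfolding a_def by (intro sum_mono mult_left_mono lt rt_measurable less_imp_le wt_pos)
    finally have Sq: "S * q \<le> a" .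
    have b: "val x M (P K) (0, \<sigma>, True) \<le> 1 + a + (1 + 2 * C) * (S * q) + W * q"
      using v D(2) unfolding a_def[symmetric] q_def[symmetric] by (simp add: algebra_simps)
    have C0: "0 \<le> 1 + 2 * C" using C_props(1) by simp
    have Wq: "W * q \<le> W" using W0 q by (simp add: mult_left_le)
    \<comment> \<open>By Markov's inequality \<open>S * q\<close> is at most the simulated time
      \<open>a\<close>, so a return adds at most \<open>(1 + 2 * C) * a\<close>.\<close>
    have b2: "val x M (P K) (0, \<sigma>, True) \<le> 1 + (2 + 2 * C) * a + W"
      using b Wq mult_left_mono[OF Sq C0] by (simp add: algebra_simps)
    have C2: "0 \<le> 2 + 2 * C" using C_props(1) by simp
    have 1: "val x M (P K) (0, \<sigma>, True) \<le> 1 + (2 + 2 * C) * S + W"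
      using b2 mult_left_mono[OF a C2] by simp
    have 2: "val x M (P K) (0, \<sigma>, True) \<le> 1 + (2 + 2 * C) * (c + 1) + W"
      and 3: "S * late_prob A S x \<le> \<delta> / 2 \<Longrightarrow> S * late_prob A S (- x) \<le> \<delta> / 2 \<Longrightarrow>
         val x M (P K) (0, \<sigma>, True) \<le> 2 + c + (1 + 2 * C) * \<delta> + \<delta> * W"
      if c: "x \<in> Z" "- x \<in> Z" "trunc_time A S x \<le> c" "trunc_time A S (- x) \<le> c" for c
    proof -
      have "a \<le> trunc_time A S (\<tau> * x) + e" "q \<le> late_prob A S (\<tau> * x) + e"
        unfolding a_def q_def using *[of "\<tau> * x"] \<tau> c by auto
      moreover have "trunc_time A S (\<tau> * x) \<le> c" using \<tau> c by auto
      ultimately have ac: "a \<le> c + 1" and ql: "q \<le> late_prob A S (\<tau> * x) + e" using e by auto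
      show "val x M (P K) (0, \<sigma>, True) \<le> 1 + (2 + 2 * C) * (c + 1) + W"
        using b2 mult_left_mono[OF ac C2] by simp
      show "val x M (P K) (0, \<sigma>, True) \<le> 2 + c + (1 + 2 * C) * \<delta> + \<delta> * W"
        if l: "S * late_prob A S x \<le> \<delta> / 2" "S * late_prob A S (- x) \<le> \<delta> / 2"
      proof -
        have "S * late_prob A S (\<tau> * x) \<le> \<delta> / 2" using l \<tau> by auto
        then have Sq': "S * q \<le> \<delta>"
          using mult_left_mono[OF ql S0(2)] e(3) by (simp add: algebra_simps)
        have "q \<le> S * q" using S q by (simp add: mult_right_mono[of 1 S q, simplified])
        then have "q \<le> \<delta>" using Sq' by simp
        then have "W * q \<le> \<delta> * W" using W0 by (simp add: mult_left_mono mult.commute)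
        then show ?thesis using b ac mult_left_mono[OF Sq' C0] by linarith
      qed
    qed
    show ?thesis using 1 2 3 by blast
  qed
  have 1: "origin_le x M (P K) (1 + (2 + 2 * C) * S + W)"
    if "0 \<le> M" "x \<noteq> 0" "origin_le x M K W" for x M K W
    unfolding origin_le_def using main[OF that] by blast
  have 2: "origin_le x M (P K) (1 + (2 + 2 * C) * (c + 1) + W)"
    if "0 \<le> M" "x \<noteq> 0" "origin_le x M K W" and
      c: "x \<in> Z" "- x \<in> Z" "trunc_time A S x \<le> c" "trunc_time A S (- x) \<le> c" for x M K W c
    unfolding origin_le_def using main[OF that(1-3)] c by blast
  have 3: "origin_le x M (P K) (2 + c + (1 + 2 * C) * \<delta> + \<delta> * W)"
    if "0 \<le> M" "x \<noteq> 0" "origin_le x M K W" and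
      c: "x \<in> Z" "- x \<in> Z" "trunc_time A S x \<le> c" "trunc_time A S (- x) \<le> c"
        "S * late_prob A S x \<le> \<delta> / 2" "S * late_prob A S (- x) \<le> \<delta> / 2" for x M K W c
    unfolding origin_le_def using main[OF that(1-3)] c by blast
  show ?thesis
    by (intro exI[of _ P] conjI causal allI impI; (rule 1 2 3; assumption))
qed

section \<open>Deadlines and the sequence of phases\<close>

definition targets :: "nat \<Rightarrow> nat \<Rightarrow> real set" where
  "targets X Y = {z. \<exists>k. X \<le> k \<and> k \<le> Y \<and> (z = real k \<or> z = - real k)}"

lemma finite_targets: "finite (targets X Y)"
proof -
  have "targets X Y \<subseteq> real ` {..Y} \<union> (\<lambda>k. - real k) ` {..Y}"
    by (auto simp: targets_def)
  then show ?thesis by (rule finite_subset) simp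
qed

text \<open>The next deadline must be safe for all targets up to \<open>Q * R k\<close>; these are
  finitely many because only integer distances count. The factor \<open>Q\<close> leaves a gap:
  beyond \<open>Q * R k\<close>, a phase with deadline at most \<open>R k\<close> costs only a
  fraction of order \<open>1 / Q\<close> of the distance.\<close>

lemma exists_thresholds:
  assumes A: "faulty_agent p A" and fin: "\<And>k. X \<le> k \<Longrightarrow> expected_time p A (real k) \<le> ennreal (c * real k)"
    "\<And>k. X \<le> k \<Longrightarrow> expected_time p A (- real k) \<le> ennreal (c * real k)" and \<delta>: "0 < \<delta>"
  shows "\<exists>R. (\<forall>k. 1 \<le> R k \<and> Q * R k \<le> R (Suc k) \<and>
    (\<forall>z\<in>targets X (Q * R k). real (R (Suc k)) * late_prob A (real (R (Suc k))) z \<le> \<delta>))"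
proof -
  have "\<exists>R. \<forall>k. 1 \<le> R k \<and> (Q * R k \<le> R (Suc k) \<and>
    (\<forall>z\<in>targets X (Q * R k). real (R (Suc k)) * late_prob A (real (R (Suc k))) z \<le> \<delta>))"
  proof (rule dependent_nat_choice)
    fix r k :: nat
    have "eventually (\<lambda>n. real n * late_prob A (real n) z < \<delta>) sequentially" if z: "z \<in> targets X (Q * r)" for z
    proof -
      obtain k where "X \<le> k" "z = real k \<or> z = - real k" using z unfolding targets_def by blast
      then have "expected_time p A z \<le> ennreal (c * real k)"
        using fin[of k] by (elim disjE) (simp_all only:)
      from order_tendstoD(2)[OF late_prob_tendsto[OF A this] \<delta>] show ?thesis .
    qed
    then have "eventually (\<lambda>n. \<forall>z\<in>targets X (Q * r). real n * late_prob A (real n) z < \<delta>) sequentially"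
      by (intro eventually_ball_finite finite_targets) auto
    then have "eventually (\<lambda>n. 1 \<le> n \<and> Q * r \<le> n \<and>
      (\<forall>z\<in>targets X (Q * r). real n * late_prob A (real n) z < \<delta>)) sequentially"
      by (intro eventually_conj eventually_ge_at_top)
    then show "\<exists>n. 1 \<le> n \<and> Q * r \<le> n \<and> (\<forall>z\<in>targets X (Q * r). real n * late_prob A (real n) z \<le> \<delta>)"
      by (auto simp: eventually_sequentially intro: less_imp_le)
  qed auto
  then show ?thesis by blast
qed

lemma exists_phases:
  assumes A: "faulty_agent p A" and c: "0 \<le> c" and X: "1 \<le> X"
    and fin: "\<And>k. X \<le> k \<Longrightarrow> expected_time p A (real k) \<le> ennreal (c * real k)"
    "\<And>k. X \<le> k \<Longrightarrow> expected_time p A (- real k) \<le> ennreal (c * real k)"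
    and \<delta>: "0 < \<delta>" "\<delta> \<le> 1" and Q: "2 \<le> Q"
  shows "\<exists>R P. (\<forall>k. 1 \<le> R k \<and> Q * R k \<le> R (Suc k)) \<and> (\<forall>k. causal (P k)) \<and>
    (\<forall>k l x M K W. 0 \<le> M \<longrightarrow> X \<le> l \<longrightarrow> x = real l \<or> x = - real l \<longrightarrow> origin_le x M K W \<longrightarrow>
      origin_le x M (P k K) (1 + (2 + 2 * C) * real (R k) + W) \<and>
      origin_le x M (P k K) (1 + (2 + 2 * C) * ((c + 1) * real l + 1) + W) \<and>
      (\<forall>j. k = Suc j \<longrightarrow> l \<le> Q * R j \<longrightarrow>
        origin_le x M (P k K) (2 + c * real l + (1 + 2 * C) * \<delta> + \<delta> * W)))"
proof -
  have "\<exists>R. \<forall>k. 1 \<le> R k \<and> Q * R k \<le> R (Suc k) \<and>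
    (\<forall>z\<in>targets X (Q * R k). real (R (Suc k)) * late_prob A (real (R (Suc k))) z \<le> \<delta> / 2)"
    using \<delta> by (intro exists_thresholds[OF A, where c = c] fin) auto
  then obtain R where R: "\<And>k. 1 \<le> R k" "\<And>k. Q * R k \<le> R (Suc k)"
    and late: "\<And>k z. z \<in> targets X (Q * R k) \<Longrightarrow> real (R (Suc k)) * late_prob A (real (R (Suc k))) z \<le> \<delta> / 2"
    by blast
  have R': "1 \<le> real (R k)" for k using R(1)[of k] by simp
  have "\<forall>k. \<exists>P. causal P \<and> (\<forall>x M K W. 0 \<le> M \<longrightarrow> x \<noteq> 0 \<longrightarrow> origin_le x M K W \<longrightarrow>
      origin_le x M (P K) (1 + (2 + 2 * C) * real (R k) + W) \<and>
      (\<forall>c. x \<in> targets X (R k) \<longrightarrow> - x \<in> targets X (R k) \<longrightarrow>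
        trunc_time A (real (R k)) x \<le> c \<longrightarrow> trunc_time A (real (R k)) (- x) \<le> c \<longrightarrow>
        origin_le x M (P K) (1 + (2 + 2 * C) * (c + 1) + W) \<and>
        (real (R k) * late_prob A (real (R k)) x \<le> \<delta> / 2 \<longrightarrow>
         real (R k) * late_prob A (real (R k)) (- x) \<le> \<delta> / 2 \<longrightarrow>
         origin_le x M (P K) (2 + c + (1 + 2 * C) * \<delta> + \<delta> * W))))"
    by (intro allI exists_phase_agent A finite_targets \<delta> R')
  from choice[OF this] obtain P where P: "\<forall>k. causal (P k) \<and> (\<forall>x M K W. 0 \<le> M \<longrightarrow> x \<noteq> 0 \<longrightarrow> origin_le x M K W \<longrightarrow>
      origin_le x M (P k K) (1 + (2 + 2 * C) * real (R k) + W) \<and>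
      (\<forall>c. x \<in> targets X (R k) \<longrightarrow> - x \<in> targets X (R k) \<longrightarrow>
        trunc_time A (real (R k)) x \<le> c \<longrightarrow> trunc_time A (real (R k)) (- x) \<le> c \<longrightarrow>
        origin_le x M (P k K) (1 + (2 + 2 * C) * (c + 1) + W) \<and>
        (real (R k) * late_prob A (real (R k)) x \<le> \<delta> / 2 \<longrightarrow>
         real (R k) * late_prob A (real (R k)) (- x) \<le> \<delta> / 2 \<longrightarrow>
         origin_le x M (P k K) (2 + c + (1 + 2 * C) * \<delta> + \<delta> * W))))" ..
  have "origin_le x M (P k K) (1 + (2 + 2 * C) * real (R k) + W) \<and>
      origin_le x M (P k K) (1 + (2 + 2 * C) * ((c + 1) * real l + 1) + W) \<and>
      (\<forall>j. k = Suc j \<longrightarrow> l \<le> Q * R j \<longrightarrow>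
        origin_le x M (P k K) (2 + c * real l + (1 + 2 * C) * \<delta> + \<delta> * W))"
    if M: "0 \<le> M" and l: "X \<le> l" and x: "x = real l \<or> x = - real l"
      and W: "origin_le x M K W" for k l x M K W
  proof -
    have x0: "x \<noteq> 0" using x l X by auto
    note bounds = P[THEN spec[of _ k], THEN conjunct2, rule_format, OF M x0 W]
    note 1 = bounds[THEN conjunct1]
    have tt: "trunc_time A (real (R k)) x \<le> c * real l" "trunc_time A (real (R k)) (- x) \<le> c * real l"
      using x fin[OF l] c by (auto intro!: trunc_time_le[OF A])
    have Z: "x \<in> targets X Y" "- x \<in> targets X Y" if "l \<le> Y" for Y
      using x l that unfolding targets_def by auto
    have C2: "0 \<le> 2 + 2 * C" using C_props(1) by simp
    \<comment> \<open>The bound is meant for every phase. If the target lies beyond the deadline,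
      the table was not chosen for it, but then the deadline itself is at most
      \<open>l\<close>.\<close>
    have 2: "origin_le x M (P k K) (1 + (2 + 2 * C) * ((c + 1) * real l + 1) + W)"
    proof (cases "l \<le> R k")
      case True
      have "(2 + 2 * C) * (c * real l + 1) \<le> (2 + 2 * C) * ((c + 1) * real l + 1)"
        by (intro mult_left_mono C2) (simp add: algebra_simps)
      moreover have "origin_le x M (P k K) (1 + (2 + 2 * C) * (c * real l + 1) + W)"
        using bounds[THEN conjunct2] Z[OF True] tt by blast
      ultimately show ?thesis by (elim origin_le_mono) linarith
    next
      case False
      have "0 \<le> c * real l" "real (R k) \<le> real l" using False c by auto
      then have "real (R k) \<le> (c + 1) * real l + 1" by (simp add: algebra_simps)
      then have "(2 + 2 * C) * real (R k) \<le> (2 + 2 * C) * ((c + 1) * real l + 1)"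
        by (intro mult_left_mono C2)
      then show ?thesis using 1 by (elim origin_le_mono) linarith
    qed
    have 3: "origin_le x M (P k K) (2 + c * real l + (1 + 2 * C) * \<delta> + \<delta> * W)"
      if k: "k = Suc j" and lj: "l \<le> Q * R j" for j
    proof -
      have lk: "l \<le> R k" using R(2)[of j] k lj by simp
      show ?thesis
        using bounds[THEN conjunct2] Z[OF lk] tt late[OF Z(1)[OF lj]] late[OF Z(2)[OF lj]] unfolding k by blast
    qed
    show ?thesis using 1 2 3 by blast
  qed
  then show ?thesis using R P by (intro exI[of _ R] exI[of _ P] conjI allI impI) blast+
qed

text \<open>The surplus \<open>\<eta>\<close> is spent in three equal parts: \<open>\<delta>\<close>
  limits what repetitions after the critical phase add, \<open>Q\<close> the phases before it, and
  \<open>L\<close> the critical phase itself.\<close>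

lemma derandomize:
  assumes A: "faulty_agent p A" and c: "0 \<le> c" and X: "1 \<le> X"
    and fin: "\<And>k. X \<le> k \<Longrightarrow> expected_time p A (real k) \<le> ennreal (c * real k)"
    "\<And>k. X \<le> k \<Longrightarrow> expected_time p A (- real k) \<le> ennreal (c * real k)"
    and \<eta>: "0 < \<eta>"
  shows "\<exists>B c'. (\<forall>h. ok (B h)) \<and> 0 \<le> c' \<and> (\<forall>l x. X \<le> l \<longrightarrow> x = real l \<or> x = - real l \<longrightarrow>
    expected_time p B x \<le> ennreal ((c + \<eta>) * real l + c'))"
proof -
  have C1: "1 \<le> C" by (rule C_props)
  \<comment> \<open>The three constraints give
    \<open>1 / (1 - \<delta>) \<le> 1 + 2 * \<delta>\<close>, then
    \<open>(1 + 2 * C) * \<delta> \<le> 1\<close>, and finally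
    \<open>2 * c * \<delta> \<le> \<eta> / 3\<close>.\<close>
  define \<delta> where "\<delta> = min (1 / 2) (min (1 / (1 + 2 * C)) (\<eta> / (6 * (c + 1))))"
  have \<delta>: "0 < \<delta>" "\<delta> \<le> 1 / 2" "\<delta> \<le> 1 / (1 + 2 * C)" "\<delta> \<le> \<eta> / (6 * (c + 1))"
  proof -
    show "0 < \<delta>" using C1 c \<eta> unfolding \<delta>_def by simp
  qed (unfold \<delta>_def, (intro min.cobounded1 min.coboundedI2[OF min.cobounded1] min.coboundedI2[OF min.cobounded2])+)
  have \<delta>C: "(1 + 2 * C) * \<delta> \<le> 1" using \<delta>(3) C1 by (simp add: field_simps)
  have \<delta>c: "6 * (c + 1) * \<delta> \<le> \<eta>" using \<delta>(4) c by (simp add: field_simps)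
  obtain Q0 :: nat where Q0: "6 * (3 + 2 * C) / \<eta> < real Q0" using reals_Archimedean2 by blast
  define Q where "Q = max 2 Q0"
  have Q: "2 \<le> Q" "2 * (3 + 2 * C) / Q \<le> \<eta> / 3"
  proof -
    have "6 * (3 + 2 * C) / \<eta> \<le> real Q" using Q0 unfolding Q_def by simp
    then have "6 * (3 + 2 * C) \<le> real Q * \<eta>" using \<eta> by (simp add: divide_le_eq)
    moreover have "0 < real Q" by (simp add: Q_def)
    ultimately show "2 * (3 + 2 * C) / Q \<le> \<eta> / 3" by (simp add: field_simps)
  qed (simp add: Q_def)
  obtain L0 :: nat where L0: "6 * ((2 + 2 * C) * (c + 1)) / \<eta> < real L0" using reals_Archimedean2 by blast
  define L where "L = max 1 L0"
  have L: "1 \<le> L" "2 / L * ((2 + 2 * C) * (c + 1)) \<le> \<eta> / 3"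
  proof -
    have "6 * ((2 + 2 * C) * (c + 1)) / \<eta> \<le> real L" using L0 unfolding L_def by simp
    then have "6 * ((2 + 2 * C) * (c + 1)) \<le> real L * \<eta>" using \<eta> by (simp add: divide_le_eq)
    moreover have "0 < real L" by (simp add: L_def)
    ultimately show "2 / L * ((2 + 2 * C) * (c + 1)) \<le> \<eta> / 3" by (simp add: field_simps)
  qed (simp add: L_def)
  have "\<delta> \<le> 1" using \<delta>(2) by simp
  have "\<exists>R P. (\<forall>k. 1 \<le> R k \<and> Q * R k \<le> R (Suc k)) \<and> (\<forall>k. causal (P k)) \<and>
    (\<forall>k l x M K W. 0 \<le> M \<longrightarrow> X \<le> l \<longrightarrow> x = real l \<or> x = - real l \<longrightarrow> origin_le x M K W \<longrightarrow>
      origin_le x M (P k K) (1 + (2 + 2 * C) * real (R k) + W) \<and>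
      origin_le x M (P k K) (1 + (2 + 2 * C) * ((c + 1) * real l + 1) + W) \<and>
      (\<forall>j. k = Suc j \<longrightarrow> l \<le> Q * R j \<longrightarrow>
        origin_le x M (P k K) (2 + c * real l + (1 + 2 * C) * \<delta> + \<delta> * W)))"
    by (rule exists_phases[OF A c X fin \<delta>(1) \<open>\<delta> \<le> 1\<close> Q(1)])
  then obtain R P where R': "\<forall>k. 1 \<le> R k \<and> Q * R k \<le> R (Suc k)"
    and causal: "\<forall>k. causal (P k)"
    and bounds: "\<forall>k l x M K W. 0 \<le> M \<longrightarrow> X \<le> l \<longrightarrow> x = real l \<or> x = - real l \<longrightarrow> origin_le x M K W \<longrightarrow>
      origin_le x M (P k K) (1 + (2 + 2 * C) * real (R k) + W) \<and>
      origin_le x M (P k K) (1 + (2 + 2 * C) * ((c + 1) * real l + 1) + W) \<and>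
      (\<forall>j. k = Suc j \<longrightarrow> l \<le> Q * R j \<longrightarrow>
        origin_le x M (P k K) (2 + c * real l + (1 + 2 * C) * \<delta> + \<delta> * W))"
    by (elim exE conjE) (rule that)
  have R: "1 \<le> R k" "Q * R k \<le> R (Suc k)" for k using R' by auto
  have R2: "2 * R k \<le> R (Suc k)" for k
    using R(2)[of k] mult_le_mono1[OF Q(1), of "R k"] by linarith
  have R_mono: "R k \<le> R k'" if "k \<le> k'" for k k'
  proof (rule lift_Suc_mono_le[of R, OF _ that])
    show "R k \<le> R (Suc k)" for k using R2[of k] by simp
  qed
  have R_double: "2 * R k \<le> R k'" if "k < k'" for k k'
    using R2[of k] R_mono[of "Suc k" k'] that by simp
  have R_unbounded: "k \<le> R k" for k
  proof (induction k)
    case (Suc k)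
    then show ?case using R2[of k] R(1)[of k] by simp
  qed simp
  \<comment> \<open>\<open>j\<close> is the offset: \<open>B j\<close> uses only the deadlines whose
    index is \<open>j\<close> plus a multiple of \<open>L\<close>.\<close>
  have "\<exists>B. \<forall>j m. B j m = P (m * L + j) (B j (Suc m))"
    using causal unfolding causal_def by (intro choice allI exists_chain) blast
  then obtain B where B: "\<And>j m. B j m = P (m * L + j) (B j (Suc m))" by blast
  have okB: "ok (B j m h)" for j m h
    by (rule chain_ok[where P = "\<lambda>m. P (m * L + j)" and B = "B j", OF B]) (use causal in \<open>unfold causal_def, blast\<close>)
  define f where "f = (\<lambda>i j. if j mod L = i then 1 else 0 :: real)"
  have f_mean: "(\<integral>j. f i j \<partial>measure_pmf (pmf_of_set {..<L})) = 1 / L" if "i < L" for i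
  proof -
    have ne: "{..<L} \<noteq> {}" "finite {..<L}" using L(1) by (auto simp: lessThan_empty_iff)
    have "(\<integral>j. f i j \<partial>measure_pmf (pmf_of_set {..<L})) = (\<Sum>j<L. f i j) / card {..<L}"
      by (rule integral_pmf_of_set[OF ne])
    also have "(\<Sum>j<L. f i j) = (\<Sum>j<L. if j = i then 1 else 0)"
      unfolding f_def by (intro sum.cong) auto
    finally show ?thesis using that by simp
  qed
  \<comment> \<open>The offset is drawn with the same sampling lemma, now imitating the uniform
    distribution on the residues. Each residue gets \<open>1 / L\<close> plus an error of at most
    \<open>1 / L\<close>, whence \<open>2 / L\<close>. Sampled numbers need not be below
    \<open>L\<close>, so they are used modulo \<open>L\<close>.\<close>
  have "\<exists>N s. \<forall>i\<in>{..<L}. \<bar>(\<Sum>bs\<in>words N. wt bs * f i (s bs)) -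
      (\<integral>j. f i j \<partial>measure_pmf (pmf_of_set {..<L}))\<bar> \<le> 1 / L"
    by (rule sampling_bits[where S = 1]) (use L(1) in \<open>auto simp: f_def prob_space_measure_pmf\<close>)
  then obtain N s where s: "\<And>i. i < L \<Longrightarrow> (\<Sum>bs\<in>words N. wt bs * f i (s bs)) \<le> 2 / L"
    using f_mean by (fastforce simp: abs_le_iff)
  \<comment> \<open>The excursion with ignored bit gets the agent moving, since the later bounds are
    stated for states in which it has moved.\<close>
  define B0 where "B0 = excursion 1 (\<lambda>_. bits N 1 (\<lambda>bs. B (s bs mod L) 0))"
  define c' where "c' = (real N + 1) * (1 + C) + 6 + 2 * (3 + 2 * C)"
  have "ok (B0 h)" for h
    unfolding B0_def
    by (rule excursion_rel[where Q = "\<lambda>a _. ok a"], simp, simp,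
        rule bits_rel[where Q = "\<lambda>a _. ok a"]) (auto intro: okB)
  moreover have "0 \<le> c'" using C1 unfolding c'_def by simp
  moreover have "expected_time p B0 x \<le> ennreal ((c + \<eta>) * real l + c')"
    if l: "X \<le> l" and x: "x = real l \<or> x = - real l" for l x
  proof (rule expected_time_le)
    show "ok (B0 h)" for h by fact
    show "0 \<le> (c + \<eta>) * real l + c'" using c \<eta> \<open>0 \<le> c'\<close> by simp
    fix M :: nat
    have M: "0 \<le> real M" by simp
    have bound: "origin_le x M (P k K) (1 + (2 + 2 * C) * real (R k) + W)"
      "origin_le x M (P k K) (1 + (2 + 2 * C) * ((c + 1) * real l + 1) + W)"
      "\<And>j. k = Suc j \<Longrightarrow> l \<le> Q * R j \<Longrightarrow>
        origin_le x M (P k K) (2 + c * real l + (1 + 2 * C) * \<delta> + \<delta> * W)"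
      if "origin_le x M K W" for k K W
      using bounds[rule_format, OF M l x that] by blast+
    \<comment> \<open>The fixed point of \<open>H = 3 + c * real l + \<delta> * H\<close>: each
      phase past the critical one costs at most the first two terms and leads to another one with
      factor \<open>\<delta>\<close>.\<close>
    define H where "H = (3 + c * real l) / (1 - \<delta>)"
    have H: "3 + c * real l + \<delta> * H = H" "0 \<le> H"
      using \<delta> c by (auto simp: H_def field_simps)
    have "\<exists>k. l \<le> Q * R k"
    proof -
      have "R l \<le> Q * R l" using Q(1) by simp
      then show ?thesis using R_unbounded[of l] by (meson le_trans)
    qed
    \<comment> \<open>The critical index: later phases satisfy the third bound, and earlier
      deadlines are smaller than \<open>l / Q\<close>.\<close>
    then obtain k0 where k0: "l \<le> Q * R k0" and k0_least: "\<And>k. k < k0 \<Longrightarrow> Q * R k < l"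
      using exists_least_iff[of "\<lambda>k. l \<le> Q * R k"] by (auto simp: not_le)
    have far: "origin_le x M (B j m) H" if "k0 < m * L + j" for j m
    proof -
      have *: "origin_le x M (B j m) (H + \<delta> ^ n * M)" if "k0 < m * L + j" for m n
        using that
      proof (induction n arbitrary: m)
        case 0
        then show ?case
          unfolding origin_le_def using val_le[OF M, of x "B j m"] H(2) by (simp add: add_increasing)
      next
        case (Suc n)
        obtain i where i: "m * L + j = Suc i" using Suc.prems by (cases "m * L + j") auto
        have "R k0 \<le> R i" using R_mono[of k0 i] i Suc.prems by simp
        then have "l \<le> Q * R i" using k0 by (meson le_trans mult_le_mono2)
        moreover have "origin_le x M (B j (Suc m)) (H + \<delta> ^ n * M)"
          using Suc.IH[of "Suc m"] Suc.prems by simp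
        ultimately have "origin_le x M (B j m) (2 + c * real l + (1 + 2 * C) * \<delta> + \<delta> * (H + \<delta> ^ n * M))"
          using bound(3)[OF _ i] unfolding B[of j m] by blast
        then have "origin_le x M (B j m) ((3 + c * real l + \<delta> * H) + \<delta> ^ Suc n * M)"
          by (rule origin_le_mono) (use \<delta>C in \<open>simp add: algebra_simps\<close>)
        then show ?case unfolding H(1) .
      qed
      have "(\<lambda>n. H + \<delta> ^ n * M) \<longlonglongrightarrow> H + 0 * real M"
        using \<delta>(1,2) by (intro tendsto_intros) auto
      from LIMSEQ_le_const[OF this] show ?thesis
        unfolding origin_le_def using *[OF that] by (auto simp: origin_le_def)
    qed
    define G where "G = 1 + (2 + 2 * C) * ((c + 1) * real l + 1)"
    \<comment> \<open>The critical phase is carried out for a single residue of the offset and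
      skipped for all others.\<close>
    define V where "V = (\<lambda>j. H + (if k0 mod L = j then G else 0))"
    have G0: "0 \<le> G" using C1 c unfolding G_def by simp
    have near: "origin_le x M (B j m) (V j)" if "k0 \<le> m * L + j" "j < L" for j m
    proof (cases "k0 = m * L + j")
      case True
      then have "k0 mod L = j" using that by simp
      moreover have "origin_le x M (B j (Suc m)) H"
        by (rule far) (use True L(1) in simp)
      ultimately show ?thesis
        using bound(2)[of "B j (Suc m)" H "m * L + j"] unfolding B[of j m] V_def G_def
        by (simp add: add.commute)
    next
      case False
      then have "origin_le x M (B j m) H" using far that by simp
      then show ?thesis by (rule origin_le_mono) (use G0 in \<open>simp add: V_def\<close>)
    qed
    \<comment> \<open>Deadlines at least double, so those from \<open>R (m * L + j)\<close> up to
      \<open>R (k0 - 1)\<close> sum to at most \<open>2 * R (k0 - 1) - R (m * L + j)\<close>. The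
      factor is \<open>3 + 2 * C\<close> instead of \<open>2 + 2 * C\<close> because
      \<open>1 \<le> R k\<close> absorbs the constant cost of a phase.\<close>
    have early: "origin_le x M (B j m) (V j + (3 + 2 * C) * (2 * real (R (k0 - 1)) - real (R (m * L + j))))"
      if "m * L + j < k0" "j < L" for j m
      using that
    proof (induction "k0 - m" arbitrary: m rule: less_induct)
      case less
      define W where "W = V j + (3 + 2 * C) * (2 * real (R (k0 - 1)) - 2 * real (R (m * L + j)))"
      have C3: "0 \<le> 3 + 2 * C" using C1 by simp
      have Rk: "real (R (m * L + j)) \<le> real (R (k0 - 1))" using R_mono less.prems by simp
      have "m \<le> m * L" using L(1) by simp
      have "origin_le x M (B j (Suc m)) W"
      proof (cases "Suc m * L + j < k0")
        case True
        have "m * L < k0" using True by simp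
        then have "m < k0" using \<open>m \<le> m * L\<close> by linarith
        then have "origin_le x M (B j (Suc m))
          (V j + (3 + 2 * C) * (2 * real (R (k0 - 1)) - real (R (Suc m * L + j))))"
          using less.hyps[of "Suc m"] True less.prems by simp
        then show ?thesis
        proof (rule origin_le_mono)
          have "2 * R (m * L + j) \<le> R (Suc m * L + j)"
            using R_double[of "m * L + j" "Suc m * L + j"] L(1) by simp
          then have "2 * real (R (m * L + j)) \<le> real (R (Suc m * L + j))"
            by (simp flip: of_nat_le_iff)
          then show "V j + (3 + 2 * C) * (2 * real (R (k0 - 1)) - real (R (Suc m * L + j))) \<le> W"
            unfolding W_def by (intro add_left_mono mult_left_mono C3) simp
        qed
      next
        case False
        then have "origin_le x M (B j (Suc m)) (V j)" using near less.prems by simp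
        moreover have "0 \<le> (3 + 2 * C) * (2 * real (R (k0 - 1)) - 2 * real (R (m * L + j)))"
          using C3 Rk by simp
        ultimately show ?thesis unfolding W_def by (elim origin_le_mono) simp
      qed
      from bound(1)[OF this]
      have "origin_le x M (B j m) (1 + (2 + 2 * C) * real (R (m * L + j)) + W)"
        unfolding B[of j m] .
      moreover have "1 \<le> real (R (m * L + j))" using R(1)[of "m * L + j"] by simp
      ultimately show ?case unfolding W_def by (elim origin_le_mono) (simp add: algebra_simps)
    qed
    define T where "T = 2 * (3 + 2 * C) / Q * real l"
    have T0: "0 \<le> T" using C1 unfolding T_def by simp
    have val_B: "origin_le x M (B j 0) (V j + T)" if j: "j < L" for j
    proof (cases "j < k0")
      case True
      have "Q * R (k0 - 1) < l" using k0_least[of "k0 - 1"] True by simp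
      then have "real (Q * R (k0 - 1)) \<le> real l" by linarith
      then have "(3 + 2 * C) * (2 * real (R (k0 - 1))) \<le> T"
        using C1 Q(1) mult_left_mono[of "real Q * real (R (k0 - 1))" "real l" "2 * (3 + 2 * C)"]
        unfolding T_def by (simp add: pos_le_divide_eq algebra_simps)
      moreover have "0 \<le> (3 + 2 * C) * real (R j)" using C1 by simp
      moreover have "origin_le x M (B j 0) (V j + (3 + 2 * C) * (2 * real (R (k0 - 1)) - real (R j)))"
        using early[of 0 j] True j by simp
      ultimately show ?thesis by (elim origin_le_mono) (simp add: right_diff_distrib)
    next
      case False
      then have "origin_le x M (B j 0) (V j)" using near[of 0 j] j by simp
      then show ?thesis by (rule origin_le_mono) (simp add: T0)
    qed
    have "val x M (bits N 1 (\<lambda>bs. B (s bs mod L) 0)) (0, -1, True) \<le> N * (1 + C) * 1 +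
      (\<Sum>bs\<in>words N. wt bs * val x M (B (s bs mod L) 0) (0, (-1) ^ N * -1, True))"
      by (rule val_bits[OF M]) auto
    also have "\<dots> \<le> N * (1 + C) + (\<Sum>bs\<in>words N. wt bs * (V (s bs mod L) + T))"
    proof -
      have "(-1 :: real) ^ N * -1 = 1 \<or> (-1 :: real) ^ N * -1 = -1" by (cases "even N") auto
      then show ?thesis
        using L(1) by (intro add_mono sum_mono mult_left_mono origin_leD[OF val_B]) (auto intro: less_imp_le wt_pos)
    qed
    also have "(\<Sum>bs\<in>words N. wt bs * (V (s bs mod L) + T)) =
      H + T + G * (\<Sum>bs\<in>words N. wt bs * f (k0 mod L) (s bs))"
    proof -
      have "wt bs * (V (s bs mod L) + T) = wt bs * (H + T) + G * (wt bs * f (k0 mod L) (s bs))" for bs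
        unfolding V_def f_def by (auto simp: algebra_simps)
      then show ?thesis
        by (simp add: sum.distrib sum_wt flip: sum_distrib_left sum_distrib_right)
    qed
    also have "G * (\<Sum>bs\<in>words N. wt bs * f (k0 mod L) (s bs)) \<le> G * (2 / L)"
      using L(1) by (intro mult_left_mono s G0) auto
    also have "G * (2 / L) \<le> \<eta> / 3 * real l + 2 * (3 + 2 * C)"
    proof -
      have "G * (2 / L) = 2 / L * ((2 + 2 * C) * (c + 1)) * real l + 2 / L * (3 + 2 * C)"
        unfolding G_def by (simp add: algebra_simps add_divide_distrib)
      moreover have "2 / L * ((2 + 2 * C) * (c + 1)) * real l \<le> \<eta> / 3 * real l"
        by (intro mult_right_mono L(2)) auto
      moreover have "2 / L * (3 + 2 * C) \<le> 2 * (3 + 2 * C)"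
        using L(1) C1 by (intro mult_right_mono) (auto simp: divide_le_eq)
      ultimately show ?thesis by linarith
    qed
    also have "T \<le> \<eta> / 3 * real l" unfolding T_def by (intro mult_right_mono Q(2)) auto
    also have "H \<le> 6 + (c + \<eta> / 3) * real l"
    proof -
      have inv: "1 / (1 - \<delta>) \<le> 1 + 2 * \<delta>" using \<delta>(1,2) by (simp add: field_simps)
      have "H = (3 + c * real l) * (1 / (1 - \<delta>))" unfolding H_def by simp
      also have "\<dots> \<le> (3 + c * real l) * (1 + 2 * \<delta>)" using inv c by (intro mult_left_mono) auto
      also have "\<dots> = 3 * (1 + 2 * \<delta>) + (c + 2 * (c * \<delta>)) * real l" by (simp add: algebra_simps)
      also have "\<dots> \<le> 6 + (c + \<eta> / 3) * real l"
        using \<delta> \<delta>c by (intro add_mono mult_right_mono) (auto simp: algebra_simps)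
      finally show ?thesis .
    qed
    finally have bits: "val x M (bits N 1 (\<lambda>bs. B (s bs mod L) 0)) (0, -1, True) \<le>
      N * (1 + C) + (6 + (c + \<eta> / 3) * real l + \<eta> / 3 * real l + (\<eta> / 3 * real l + 2 * (3 + 2 * C)))"
      by simp
    have "val x M B0 start \<le> (1 + C) * 1 + p * val x M (bits N 1 (\<lambda>bs. B (s bs mod L) 0)) (0, -1, True)
      + (1 - p) * val x M (bits N 1 (\<lambda>bs. B (s bs mod L) 0)) (0, -1, True)"
      unfolding B0_def using val_excursion[OF M, of 1 1] by auto
    also have "\<dots> = (1 + C) + val x M (bits N 1 (\<lambda>bs. B (s bs mod L) 0)) (0, -1, True)"
      by (simp add: algebra_simps)
    also have "\<dots> \<le> (c + \<eta>) * real l + c'"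
      using bits unfolding c'_def by (simp add: algebra_simps)
    finally show "val x (real M) B0 start \<le> (c + \<eta>) * real l + c'" .
  qed
  ultimately show ?thesis by blast
qed

end

section \<open>From integer distances to all targets\<close>

theorem theorem1:
  fixes p \<epsilon> :: real and c :: ennreal and A :: agent
  assumes "0 < p" and "p < 1 / 2"
    and "faulty_agent p A" and "finitely_many_queries p A"
    and "c = competitive_ratio p A"
    and "0 < \<epsilon>"
  shows "\<exists>B. faulty_agent p B \<and> deterministic B \<and> competitive_ratio p B \<le> c + ennreal \<epsilon>"
proof -
  interpret faulty p by unfold_locales fact+
  show ?thesis
  proof (cases c)
    case top
    have "ok ((\<lambda>_. wait) h)" for h :: "observation list" by (simp add: ok_intros)
    then have "faulty_agent p (\<lambda>_. wait)" "deterministic (\<lambda>_. wait)"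
      using faulty_agent_ok[of "\<lambda>_. wait"] by auto
    then show ?thesis using top by (intro exI[of _ "\<lambda>_. wait"]) simp
  next
    case (real c0)
    \<comment> \<open>One quarter of \<open>\<epsilon>\<close> separates \<open>c1\<close> from the
      limit superior, another quarter is the surplus of the derandomization, and the remaining half
      absorbs \<open>c'\<close> and the rounding of the distance for far targets.\<close>
    define c1 where "c1 = c0 + \<epsilon> / 4"
    have c1: "0 \<le> c1" "c < ennreal c1" using real assms(6) by (auto simp: c1_def ennreal_less_iff)
    have "eventually (\<lambda>x. expected_time p A x / ennreal \<bar>x\<bar> < ennreal c1) at_infinity"
      using c1(2) unfolding assms(5) competitive_ratio_def by (rule Limsup_lessD)
    then obtain b where b: "\<And>x. b \<le> \<bar>x\<bar> \<Longrightarrow> expected_time p A x / ennreal \<bar>x\<bar> < ennreal c1"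
      by (auto simp: eventually_at_infinity)
    define X where "X = max 1 (nat \<lceil>b\<rceil>)"
    have fin: "expected_time p A x \<le> ennreal (c1 * real k)" if "X \<le> k" "\<bar>x\<bar> = real k" for k x
    proof -
      have k: "0 < real k" "b \<le> real k" using that(1) unfolding X_def by linarith+
      then have "expected_time p A x / ennreal (real k) < ennreal c1" using b[of x] that(2) by simp
      then have "expected_time p A x \<le> ennreal c1 * ennreal (real k)"
        using k by (subst (asm) divide_less_ennreal) (auto intro: less_imp_le)
      then show ?thesis using c1 k by (simp add: ennreal_mult)
    qed
    have X: "1 \<le> X" unfolding X_def by simp
    have e4: "0 < \<epsilon> / 4" using assms(6) by simp
    have "\<exists>B c'. (\<forall>h. ok (B h)) \<and> 0 \<le> c' \<and> (\<forall>l x. X \<le> l \<longrightarrow> x = real l \<or> x = - real l \<longrightarrow>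
      expected_time p B x \<le> ennreal ((c1 + \<epsilon> / 4) * real l + c'))"
      by (rule derandomize[OF assms(3) c1(1) X fin fin e4]) auto
    then obtain B c' where B: "\<And>h. ok (B h)" and c': "0 \<le> c'"
      and E: "\<And>l x. X \<le> l \<Longrightarrow> x = real l \<or> x = - real l \<Longrightarrow>
        expected_time p B x \<le> ennreal ((c1 + \<epsilon> / 4) * real l + c')"
      by blast
    have "eventually (\<lambda>x. expected_time p B x / ennreal \<bar>x\<bar> \<le> ennreal (c0 + \<epsilon>)) at_infinity"
      unfolding eventually_at_infinity
    proof (intro exI allI impI)
      fix x :: real assume x: "max (real X) (2 / \<epsilon> * (c1 + \<epsilon> / 4 + c')) \<le> norm x"
      define l where "l = nat \<lceil>\<bar>x\<bar>\<rceil>"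
      have l: "\<bar>x\<bar> \<le> real l" "real l \<le> \<bar>x\<bar> + 1" "X \<le> l" using x unfolding l_def by (auto, linarith+)
      have x0: "0 < \<bar>x\<bar>" using x X by auto
      \<comment> \<open>The next integer target on the same side, which cannot be reached before
        \<open>x\<close>.\<close>
      define z where "z = sgn x * real l"
      have z: "\<bar>x\<bar> \<le> \<bar>z\<bar>" "0 < x * z" "z = real l \<or> z = - real l"
        using l x0 by (auto simp: z_def sgn_real_def abs_mult zero_less_mult_iff split: if_splits)
      have "expected_time p B x \<le> expected_time p B z"
        unfolding expected_time_def
        by (intro nn_integral_mono reach_time_mono z) (use B in \<open>auto simp: ok_def\<close>)
      also have "\<dots> \<le> ennreal ((c1 + \<epsilon> / 4) * real l + c')" by (rule E[OF l(3) z(3)])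
      also have "\<dots> \<le> ennreal ((c0 + \<epsilon>) * \<bar>x\<bar>)"
      proof (rule ennreal_leI)
        have "(c1 + \<epsilon> / 4) * real l \<le> (c1 + \<epsilon> / 4) * (\<bar>x\<bar> + 1)"
          using c1(1) e4 l(2) by (intro mult_left_mono) auto
        also have "\<dots> = (c1 + \<epsilon> / 4) * \<bar>x\<bar> + (c1 + \<epsilon> / 4)" by (simp add: distrib_left)
        finally have "(c1 + \<epsilon> / 4) * real l + c' \<le> (c1 + \<epsilon> / 4) * \<bar>x\<bar> + (c1 + \<epsilon> / 4 + c')" by simp
        also have "c1 + \<epsilon> / 4 + c' \<le> \<epsilon> / 2 * \<bar>x\<bar>"
          using x assms(6) by (simp add: field_simps)
        also have "(c1 + \<epsilon> / 4) * \<bar>x\<bar> + \<epsilon> / 2 * \<bar>x\<bar> = (c0 + \<epsilon>) * \<bar>x\<bar>"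
          unfolding c1_def by (simp add: algebra_simps)
        finally show "(c1 + \<epsilon> / 4) * real l + c' \<le> (c0 + \<epsilon>) * \<bar>x\<bar>" by simp
      qed
      also have "\<dots> = ennreal (c0 + \<epsilon>) * ennreal \<bar>x\<bar>"
        using real assms(6) by (intro ennreal_mult) auto
      finally show "expected_time p B x / ennreal \<bar>x\<bar> \<le> ennreal (c0 + \<epsilon>)"
        using x0 by (intro divide_le_posI_ennreal) (simp_all add: mult.commute)
    qed
    then have "competitive_ratio p B \<le> ennreal (c0 + \<epsilon>)"
      unfolding competitive_ratio_def by (rule Limsup_bounded)
    also have "\<dots> = c + ennreal \<epsilon>" using real assms(6) by simp
    finally have "competitive_ratio p B \<le> c + ennreal \<epsilon>" .
    then show ?thesis
      using faulty_agent_ok[where B = B, OF B] by (intro exI[of _ B] conjI)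
  qed
qed

end
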